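(* Let $X$ be a compact metric space, $f:X\to X$ a continuous map and $\mu\in\mathcal{M}(X,f)$ an $f$-invariant Borel probability measure. For any ergodic decomposition $\tau$ of $\mu$, $$E_\mu(f)=\operatorname{ess\,sup}\{h_\nu(f):\nu\in\mathcal{E}(X,f)\},$$ where the essential supremum is taken with respect to $\tau$. Consequently, $E_\mu(f)\ge h_\mu(f)$.
   Context: Let $d$ be the metric on $X$. $\mathcal{M}(X,f)$ denotes the set of $f$-invariant Borel probability measures on $X$ (weak-star topology), and $\mathcal{E}(X,f)$ the ergodic ones. $h_\mu(f)$ is the Kolmogorov–Sinai entropy. A Borel probability measure $\tau$ on $\mathcal{M}(X,f)$ is an ergodic decomposition of $\mu$ if $\tau(\mathcal{E}(X,f))=1$ and $\int_X\psi\,d\mu=\int_{\mathcal{E}(X,f)}\big(\int_X\psi\,d\nu\big)d\tau(\nu)$ for every $\psi\in L^1(\mu)$. $E_\mu(f)$ (the measure theoretic pressure of the zero potential) is defined as follows. Put $B_n(x,\epsilon)=\{y\in X:\max_{0\le i<n}d(f^ix,f^iy)<\epsilon\}$. For $Z\subset X$, $\alpha\in\mathbb{R}$, $N\in\mathbb{N}$, $\epsilon>0$ let $$M(Z,\alpha,N,\epsilon)=\inf\Big\{\sum_ie^{-\alpha n_i}:\bigcup_iB_{n_i}(x_i,\epsilon)\supset Z,\ x_i\in X,\ n_i\ge N\text{ for all }i\Big\},$$ the infimum being over finite or countable families $(x_i,n_i)_i$; $m(Z,\alpha,\epsilon)=\lim_{N\to\infty}M(Z,\alpha,N,\epsilon)$;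 $E_Z(f,\epsilon)=\inf\{\alpha:m(Z,\alpha,\epsilon)=0\}=\sup\{\alpha:m(Z,\alpha,\epsilon)=+\infty\}$; $E_\mu(f,\epsilon)=\inf\{E_Z(f,\epsilon):\mu(Z)=1\}$; and $E_\mu(f)=\lim_{\epsilon\to0}E_\mu(f,\epsilon)$. *)

theory Defs
  imports "HOL-Probability.Probability"
begin

section \<open>Invariant and ergodic measures\<close>

text \<open>The phase space is the whole type \<open>'a\<close>; its compactness is assumed in the theorem.\<close>

definition invariant_measures :: "('a::metric_space \<Rightarrow> 'a) \<Rightarrow> 'a measure set" where
  "invariant_measures f =
    {\<mu>. prob_space \<mu> \<and> sets \<mu> = sets borel \<and> f \<in> measurable \<mu> \<mu> \<and> distr \<mu> \<mu> f = \<mu>}"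

definition ergodic_measures :: "('a::metric_space \<Rightarrow> 'a) \<Rightarrow> 'a measure set" where
  "ergodic_measures f =
    {\<mu> \<in> invariant_measures f.
      \<forall>A\<in>sets \<mu>. f -` A = A \<longrightarrow> measure \<mu> A = 0 \<or> measure \<mu> A = 1}"

text \<open>The weak-star topology on the invariant measures: the coarsest one for which
  \<open>\<mu> \<mapsto> \<integral>\<phi> d\<mu>\<close> is continuous for every continuous real \<open>\<phi>\<close>.\<close>

definition weak_star_topology :: "('a::metric_space \<Rightarrow> 'a) \<Rightarrow> 'a measure topology" where
  "weak_star_topology f = topology_generated_by
    {{\<mu> \<in> invariant_measures f. (LINT x|\<mu>. \<phi> x) \<in> U} | (\<phi> :: 'a \<Rightarrow> real) U.
      continuous_on UNIV \<phi> \<and> open U}"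

lemma topspace_weak_star_topology: "topspace (weak_star_topology f) = invariant_measures f"
proof -
  have "continuous_on UNIV (\<lambda>_::'a. 0::real)" "open (UNIV :: real set)"
    by auto
  then show ?thesis
    unfolding weak_star_topology_def topology_generated_by_topspace by blast
qed

definition weak_star_borel :: "('a::metric_space \<Rightarrow> 'a) \<Rightarrow> 'a measure measure" where
  "weak_star_borel f = sigma (invariant_measures f) {U. openin (weak_star_topology f) U}"

lemma space_weak_star_borel: "space (weak_star_borel f) = invariant_measures f"
  unfolding weak_star_borel_def
  by (rule space_measure_of) (metis PowI mem_Collect_eq openin_subset subsetI topspace_weak_star_topology)

lemma sets_weak_star_borel:
  "sets (weak_star_borel f) =
    sigma_sets (invariant_measures f) {U. openin (weak_star_topology f) U}"
  unfolding weak_star_borel_def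
  by (rule sets_measure_of) (metis PowI mem_Collect_eq openin_subset subsetI topspace_weak_star_topology)

text \<open>\<open>emeasure \<tau> A = 1\<close> includes measurability of \<open>A\<close>, as \<open>emeasure\<close> vanishes off \<open>sets \<tau>\<close>.
  For \<open>\<psi>\<close> in \<open>L\<^sup>1(\<mu>)\<close> the inner integral may be undefined (and is then \<open>0\<close>)
  on a \<open>\<tau>\<close>-null set of measures \<open>\<nu>\<close> only.\<close>

definition ergodic_decomposition ::
    "('a::metric_space \<Rightarrow> 'a) \<Rightarrow> 'a measure \<Rightarrow> 'a measure measure \<Rightarrow> bool" where
  "ergodic_decomposition f \<mu> \<tau> \<longleftrightarrow>
    prob_space \<tau> \<and> sets \<tau> = sets (weak_star_borel f) \<and>
    emeasure \<tau> (ergodic_measures f) = 1 \<and>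
    (\<forall>\<psi> :: 'a \<Rightarrow> real. integrable \<mu> \<psi> \<longrightarrow>
      (LINT x|\<mu>. \<psi> x) = (LINT \<nu>:ergodic_measures f|\<tau>. (LINT x|\<nu>. \<psi> x)))"

section \<open>Kolmogorov--Sinai entropy\<close>

text \<open>The convention \<open>0 \<cdot> ln 0 = 0\<close> needs no case distinction here.\<close>

definition partition_entropy :: "'a measure \<Rightarrow> 'a set set \<Rightarrow> real" where
  "partition_entropy \<mu> P = - (\<Sum>A\<in>P. measure \<mu> A * ln (measure \<mu> A))"

text \<open>The join of the preimages of \<open>P\<close> under \<open>f ^^ i\<close> for \<open>i < n\<close>; \<open>c\<close> is an itinerary.\<close>

definition iterated_join :: "'a measure \<Rightarrow> ('a \<Rightarrow> 'a) \<Rightarrow> 'a set set \<Rightarrow> nat \<Rightarrow> 'a set set" where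
  "iterated_join \<mu> f P n =
    {(\<Inter>i<n. (f ^^ i) -` c i) \<inter> space \<mu> | c. \<forall>i<n. c i \<in> P} - {{}}"

definition entropy_wrt_partition :: "'a measure \<Rightarrow> ('a \<Rightarrow> 'a) \<Rightarrow> 'a set set \<Rightarrow> real" where
  "entropy_wrt_partition \<mu> f P =
    lim (\<lambda>n. partition_entropy \<mu> (iterated_join \<mu> f P n) / real n)"

definition ks_entropy :: "'a measure \<Rightarrow> ('a \<Rightarrow> 'a) \<Rightarrow> ereal" where
  "ks_entropy \<mu> f =
    (SUP P \<in> {P. finite P \<and> P \<subseteq> sets \<mu> \<and> partition_on (space \<mu>) P}.
      ereal (entropy_wrt_partition \<mu> f P))"

section \<open>Measure theoretic pressure of the zero potential\<close>

definition bowen_ball :: "('a::metric_space \<Rightarrow> 'a) \<Rightarrow> nat \<Rightarrow> 'a \<Rightarrow> real \<Rightarrow> 'a set" where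
  "bowen_ball f n x \<epsilon> = {y. \<forall>i<n. dist ((f ^^ i) x) ((f ^^ i) y) < \<epsilon>}"

text \<open>Finite or countable families are indexed by an arbitrary set \<open>I\<close> of natural numbers.\<close>

definition cover_sum ::
    "('a::metric_space \<Rightarrow> 'a) \<Rightarrow> 'a set \<Rightarrow> real \<Rightarrow> nat \<Rightarrow> real \<Rightarrow> ennreal" where
  "cover_sum f Z \<alpha> N \<epsilon> =
    Inf {(\<Sum>\<^sub>\<infinity>i\<in>I. ennreal (exp (- \<alpha> * real (n i)))) | (I :: nat set) (x :: nat \<Rightarrow> 'a) n.
      Z \<subseteq> (\<Union>i\<in>I. bowen_ball f (n i) (x i) \<epsilon>) \<and> (\<forall>i\<in>I. N \<le> n i)}"

definition cover_limit :: "('a::metric_space \<Rightarrow> 'a) \<Rightarrow> 'a set \<Rightarrow> real \<Rightarrow> real \<Rightarrow> ennreal" where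
  "cover_limit f Z \<alpha> \<epsilon> = lim (\<lambda>N. cover_sum f Z \<alpha> N \<epsilon>)"

definition set_pressure :: "('a::metric_space \<Rightarrow> 'a) \<Rightarrow> 'a set \<Rightarrow> real \<Rightarrow> ereal" where
  "set_pressure f Z \<epsilon> = Inf {ereal \<alpha> | \<alpha>. cover_limit f Z \<alpha> \<epsilon> = 0}"

definition measure_pressure_at ::
    "('a::metric_space \<Rightarrow> 'a) \<Rightarrow> 'a measure \<Rightarrow> real \<Rightarrow> ereal" where
  "measure_pressure_at f \<mu> \<epsilon> = Inf {set_pressure f Z \<epsilon> | Z. Z \<in> sets \<mu> \<and> emeasure \<mu> Z = 1}"

definition measure_pressure :: "('a::metric_space \<Rightarrow> 'a) \<Rightarrow> 'a measure \<Rightarrow> ereal" where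
  "measure_pressure f \<mu> = Lim (at_right 0) (measure_pressure_at f \<mu>)"

end

theory Submission
  imports Defs
begin

text \<open>Both inequalities are proved by coding orbits with words over a finite partition, and neither needs the
  Shannon--McMillan--Breiman theorem or Birkhoff's theorem.

  Upper bound: let \<open>h\<^sub>\<nu>(f, P) < \<alpha>\<close> for an ergodic \<open>\<nu>\<close> and a partition \<open>P\<close> of small mesh. Some weight
  \<open>q\<close> on the words of some length \<open>k\<close>, which may be taken rational, has cross entropy below \<open>k \<alpha>\<close> with
  respect to \<open>\<nu>\<close>, so the Birkhoff sums of \<open>- ln q / k\<close> are infinitely often below \<open>\<alpha> n + C\<close> at
  \<open>\<nu>\<close>-almost every point (otherwise their mean would be at least \<open>\<alpha>\<close>). Since \<open>q\<close> has total mass at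
  most \<open>1\<close>, the points with this property at time \<open>n\<close> are covered by \<open>O(exp (\<alpha> n))\<close> Bowen balls. The union
  over the countably many \<open>(k, q, C)\<close> does not depend on \<open>\<nu>\<close>.

  Lower bound, for every invariant \<open>\<mu>\<close>: a cover of a set of full measure by Bowen balls of total weight at
  most \<open>1\<close> is a block code. Parsing long orbits with it yields sub-probability weights on words whose
  cost is about \<open>\<alpha>\<close> per letter, and Gibbs' inequality bounds the entropy by the mean cost. The
  ambiguity of the partition inside a Bowen ball is paid for only at visits to a set of small measure.\<close>

section \<open>Words, Gibbs' inequality and Fekete's lemma\<close>

text \<open>The two bounds have to be combined twice. First for the integrand: \<open>esssup\<close>
  is \<open>top\<close> on non-measurable functions, and \<open>ks_entropy\<close> is a supremum
  over uncountably many partitions. For an ergodic \<nu> the chain h(\<nu>) \<le> E(\<nu>) \<le> sup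
  over k of h(\<nu>, P k) \<le> h(\<nu>), with \<open>P k\<close> of mesh below 1 / (k + 1), turns
  it into a countable supremum of functions that are Borel for the weak-star topology. Then for
  \<mu>: a Borel set has full \<mu>-measure exactly when it has full \<nu>-measure for \<tau>-almost
  every \<nu>. Passing from the components to \<mu> therefore demands one set that is full for
  almost all \<nu> at once, and this is why the weights of the upper bound are drawn from a
  countable supply. Passing from \<mu> to the components is free for countably many sets, one for
  each scale, and the lower bound is then applied to \<nu>. The inequality with h(\<mu>) is the
  lower bound for \<mu> itself and does not pass through the decomposition.\<close>

definition words :: "'b set \<Rightarrow> nat \<Rightarrow> 'b list set" where
  "words A n = {w. set w \<subseteq> A \<and> length w = n}"

lemma finite_words: "finite A \<Longrightarrow> finite (words A n)"
  unfolding words_def by (rule finite_lists_length_eq)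

lemma card_words: "finite A \<Longrightarrow> card (words A n) = card A ^ n"
  unfolding words_def by (rule card_lists_length_eq)

lemma words_0 [simp]: "words A 0 = {[]}"
  by (auto simp: words_def)

lemma sum_words_add:
  fixes g :: "'b list \<Rightarrow> real"
  shows "(\<Sum>w\<in>words A (m + n). g w) = (\<Sum>u\<in>words A m. \<Sum>v\<in>words A n. g (u @ v))"
proof -
  have "(\<Sum>w\<in>words A (m + n). g w) = (\<Sum>(u, v)\<in>words A m \<times> words A n. g (u @ v))"
    by (rule sum.reindex_bij_witness[of _ "\<lambda>(u, v). u @ v" "\<lambda>w. (take m w, drop m w)"])
      (auto simp: words_def dest: in_set_takeD in_set_dropD)
  then show ?thesis
    by (simp add: sum.cartesian_product)
qed

lemma sum_words_Suc:
  fixes g :: "'b list \<Rightarrow> real"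
  shows "(\<Sum>w\<in>words A (Suc n). g w) = (\<Sum>a\<in>A. \<Sum>w\<in>words A n. g (a # w))"
proof -
  have "(\<Sum>w\<in>words A (Suc n). g w) = (\<Sum>(a, w)\<in>A \<times> words A n. g (a # w))"
    by (rule sum.reindex_bij_witness[of _ "\<lambda>(a, w). a # w" "\<lambda>w. (hd w, tl w)"])
      (auto simp: words_def length_Suc_conv)
  then show ?thesis
    by (simp add: sum.cartesian_product)
qed

lemma gibbs_inequality:
  fixes p q :: "'b \<Rightarrow> real"
  assumes "finite W" and p: "\<And>w. w \<in> W \<Longrightarrow> 0 \<le> p w" and q: "\<And>w. w \<in> W \<Longrightarrow> 0 \<le> q w"
    and pos: "\<And>w. w \<in> W \<Longrightarrow> 0 < p w \<Longrightarrow> 0 < q w"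
    and le: "(\<Sum>w\<in>W. q w) \<le> (\<Sum>w\<in>W. p w)"
  shows "(\<Sum>w\<in>W. - (p w * ln (p w))) \<le> (\<Sum>w\<in>W. - (p w * ln (q w)))"
proof -
  have "- (p w * ln (p w)) \<le> - (p w * ln (q w)) + (q w - p w)" if w: "w \<in> W" for w
  proof (cases "p w = 0")
    case True
    then show ?thesis using q[OF w] by simp
  next
    case False
    then have pp: "0 < p w" using p[OF w] by simp
    have qq: "0 < q w" using pos[OF w pp] .
    have "ln (q w / p w) \<le> q w / p w - 1"
      by (rule ln_le_minus_one) (use pp qq in simp)
    then have "p w * ln (q w / p w) \<le> p w * (q w / p w - 1)"
      using pp by (intro mult_left_mono) auto
    also have "\<dots> = q w - p w" using pp by (simp add: field_simps)
    finally show ?thesis using pp qq by (simp add: ln_div algebra_simps)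
  qed
  then have "(\<Sum>w\<in>W. - (p w * ln (p w))) \<le> (\<Sum>w\<in>W. - (p w * ln (q w)) + (q w - p w))"
    by (intro sum_mono) auto
  also have "\<dots> = (\<Sum>w\<in>W. - (p w * ln (q w))) + ((\<Sum>w\<in>W. q w) - (\<Sum>w\<in>W. p w))"
    by (simp only: sum.distrib sum_subtractf)
  finally show ?thesis using le by simp
qed

lemma subadditive_mult_le:
  fixes u :: "nat \<Rightarrow> real"
  assumes sub: "\<And>m n. u (m + n) \<le> u m + u n"
  shows "u (k * m + r) \<le> real k * u m + u r"
proof (induction k)
  case (Suc k)
  have "u (Suc k * m + r) = u (m + (k * m + r))" by (simp add: algebra_simps)
  also have "\<dots> \<le> u m + u (k * m + r)" by (rule sub)
  finally show ?case using Suc by (simp add: algebra_simps)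
qed simp

lemma fekete:
  fixes u :: "nat \<Rightarrow> real"
  assumes sub: "\<And>m n. u (m + n) \<le> u m + u n" and nn: "\<And>n. 0 \<le> u n"
  shows "convergent (\<lambda>n. u n / real n)"
proof -
  define l where "l = (INF n\<in>{0<..}. u n / real n)"
  have bdd: "bdd_below ((\<lambda>n. u n / real n) ` {0<..})"
    by (rule bdd_belowI2[of _ 0]) (simp add: nn)
  have lle: "l \<le> u n / real n" if "0 < n" for n
    unfolding l_def using that by (intro cINF_lower[OF bdd]) auto
  have lim: "(\<lambda>n. u n / real n) \<longlonglongrightarrow> l"
  proof (rule order_tendstoI)
    fix a assume "a < l"
    then show "\<forall>\<^sub>F n in sequentially. a < u n / real n"
      using lle by (intro eventually_sequentiallyI[of 1]) (metis less_le_trans zero_less_one)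
  next
    fix a assume a: "l < a"
    then obtain m where m: "0 < m" "u m / real m < a"
      unfolding l_def using cINF_less_iff[OF _ bdd, of a] by auto
    define B where "B = Max (u ` {..<m})"
    have B: "u r \<le> B" if "r < m" for r
      unfolding B_def using that by (intro Max_ge) auto
    have B0: "0 \<le> B" using B[of 0] nn[of 0] m by simp
    have up: "u n / real n \<le> u m / real m + B / real n" if "0 < n" for n
    proof -
      have "u n = u ((n div m) * m + n mod m)" by simp
      also have "\<dots> \<le> real (n div m) * u m + u (n mod m)"
        by (rule subadditive_mult_le, rule sub)
      also have "\<dots> \<le> (real n / real m) * u m + B"
        using B[of "n mod m"] m nn by (intro add_mono mult_right_mono of_nat_div_le_of_nat) auto
      finally have "u n \<le> (real n / real m) * u m + B" .
      then have "u n / real n \<le> ((real n / real m) * u m + B) / real n"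
        by (rule divide_right_mono) simp
      then show ?thesis using that by (simp add: add_divide_distrib)
    qed
    have "(\<lambda>n. u m / real m + B / real n) \<longlonglongrightarrow> u m / real m + 0"
      by (intro tendsto_add tendsto_const lim_const_over_n)
    then have "\<forall>\<^sub>F n in sequentially. u m / real m + B / real n < a"
      by (rule order_tendstoD(2)) (use m in simp)
    then show "\<forall>\<^sub>F n in sequentially. u n / real n < a"
      using eventually_gt_at_top[of 0] by eventually_elim (blast intro: up le_less_trans)
  qed
  then show ?thesis by (rule convergentI)
qed

section \<open>Itineraries and block entropy\<close>

definition itinerary :: "('a \<Rightarrow> 'a) \<Rightarrow> ('a \<Rightarrow> 'b) \<Rightarrow> nat \<Rightarrow> 'a \<Rightarrow> 'b list" where
  "itinerary f \<xi> n x = map (\<lambda>i. \<xi> ((f ^^ i) x)) [0..<n]"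

lemma length_itinerary [simp]: "length (itinerary f \<xi> n x) = n"
  by (simp add: itinerary_def)

lemma itinerary_nth [simp]: "i < n \<Longrightarrow> itinerary f \<xi> n x ! i = \<xi> ((f ^^ i) x)"
  by (simp add: itinerary_def)

lemma itinerary_0 [simp]: "itinerary f \<xi> 0 x = []"
  by (simp add: itinerary_def)

lemma itinerary_add: "itinerary f \<xi> (m + n) x = itinerary f \<xi> m x @ itinerary f \<xi> n ((f ^^ m) x)"
  by (rule nth_equalityI) (auto simp: nth_append funpow_add[symmetric, THEN fun_cong, simplified])

lemma itinerary_Suc: "itinerary f \<xi> (Suc n) x = \<xi> x # itinerary f \<xi> n (f x)"
  using itinerary_add[of f \<xi> 1 n x] by (simp add: itinerary_def)

lemma measurable_funpow:
  assumes "f \<in> measurable M M" shows "f ^^ n \<in> measurable M M"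
  by (induction n) (auto intro: measurable_compose[OF _ assms] simp: id_def)

lemma invariant_measuresD:
  assumes "\<mu> \<in> invariant_measures f"
  shows "prob_space \<mu>" "sets \<mu> = sets borel" "space \<mu> = UNIV" "f \<in> measurable \<mu> \<mu>"
    "distr \<mu> \<mu> f = \<mu>" "f \<in> borel_measurable borel"
proof -
  show *: "prob_space \<mu>" "sets \<mu> = sets borel" "f \<in> measurable \<mu> \<mu>" "distr \<mu> \<mu> f = \<mu>"
    using assms by (auto simp: invariant_measures_def)
  then show "space \<mu> = UNIV" using sets_eq_imp_space_eq[of \<mu> borel] by simp
  show "f \<in> borel_measurable borel" using * measurable_cong_sets[of \<mu> borel \<mu> borel] by simp
qed

lemma distr_funpow:
  assumes "\<mu> \<in> invariant_measures f" shows "distr \<mu> \<mu> (f ^^ n) = \<mu>"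
proof (induction n)
  case 0
  then show ?case by (simp add: id_def distr_id)
next
  case (Suc n)
  note f = invariant_measuresD(4)[OF assms]
  have "distr \<mu> \<mu> (f ^^ Suc n) = distr \<mu> \<mu> (f \<circ> (f ^^ n))" by simp
  also have "\<dots> = distr (distr \<mu> \<mu> (f ^^ n)) \<mu> f"
    by (rule distr_distr[symmetric]) (auto intro: f measurable_funpow)
  finally show ?case by (simp only: Suc invariant_measuresD(5)[OF assms])
qed

lemma measure_vimage_funpow:
  assumes "\<mu> \<in> invariant_measures f" "B \<in> sets borel"
  shows "measure \<mu> ((f ^^ n) -` B) = measure \<mu> B"
proof -
  note * = invariant_measuresD[OF assms(1)]
  have "measure \<mu> B = measure (distr \<mu> \<mu> (f ^^ n)) B" by (simp add: distr_funpow[OF assms(1)])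
  also have "\<dots> = measure \<mu> ((f ^^ n) -` B \<inter> space \<mu>)"
    by (rule measure_distr) (use assms(2) * in \<open>auto intro: measurable_funpow\<close>)
  finally show ?thesis using * by simp
qed

lemma integral_funpow:
  fixes g :: "'a::metric_space \<Rightarrow> real"
  assumes "\<mu> \<in> invariant_measures f" "g \<in> borel_measurable borel"
  shows "(LINT x|\<mu>. g ((f ^^ n) x)) = (LINT x|\<mu>. g x)"
proof -
  note * = invariant_measuresD[OF assms(1)]
  have "(LINT x|\<mu>. g x) = (LINT x|distr \<mu> \<mu> (f ^^ n). g x)" by (simp add: distr_funpow[OF assms(1)])
  also have "\<dots> = (LINT x|\<mu>. g ((f ^^ n) x))"
    by (rule integral_distr) (use assms(2) * in \<open>auto intro: measurable_funpow cong: measurable_cong_sets\<close>)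
  finally show ?thesis by simp
qed

text \<open>A partition is represented by a labelling with a finite alphabet, so that joins become
  sets of words and weights can be defined on all words, realised by an orbit or not. No measure is
  fixed here, because the covers of the upper bound are built before the measure is known.\<close>

locale coding =
  fixes f :: "'a::metric_space \<Rightarrow> 'a" and \<xi> :: "'a \<Rightarrow> 'b" and A :: "'b set"
  assumes f_borel: "f \<in> borel_measurable borel"
    and finite_A: "finite A"
    and code_in: "\<And>x. \<xi> x \<in> A"
    and code_borel: "\<And>a. a \<in> A \<Longrightarrow> \<xi> -` {a} \<in> sets borel"
begin

lemma itinerary_in: "itinerary f \<xi> n x \<in> words A n"
  using code_in by (auto simp: words_def itinerary_def)

lemma A_nonempty: "A \<noteq> {}"
  using code_in by blast

lemma card_A: "0 < card A"
  using finite_A A_nonempty by (simp add: card_gt_0_iff)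

lemma funpow_borel: "f ^^ n \<in> borel_measurable borel"
  by (rule measurable_funpow[OF f_borel])

lemma itinerary_borel: "itinerary f \<xi> n -` {w} \<in> sets borel"
proof (cases "w \<in> words A n")
  case True
  then have w: "length w = n" "\<And>i. i < n \<Longrightarrow> w ! i \<in> A" by (auto simp: words_def)
  have "itinerary f \<xi> n -` {w} = (\<Inter>i\<in>{..<n}. (f ^^ i) -` (\<xi> -` {w ! i}))"
    using w by (auto simp: list_eq_iff_nth_eq)
  also have "\<dots> \<in> sets borel"
  proof (cases "n = 0")
    case False
    show ?thesis
    proof (rule sets.finite_INT)
      fix i assume "i \<in> {..<n}"
      then have "\<xi> -` {w ! i} \<in> sets borel" using w code_borel by auto
      from measurable_sets[OF funpow_borel this, of i]
      show "(f ^^ i) -` (\<xi> -` {w ! i}) \<in> sets borel" by simp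
    qed (use False in auto)
  qed simp
  finally show ?thesis .
next
  case False
  then have "itinerary f \<xi> n -` {w} = {}" using itinerary_in by auto
  then show ?thesis by simp
qed

lemma itinerary_measurable: "itinerary f \<xi> n \<in> measurable borel (count_space (words A n))"
  using itinerary_in itinerary_borel
  by (auto simp: measurable_count_space_eq2[OF finite_words[OF finite_A]])

lemma itinerary_fun_borel: "(\<lambda>x. g (itinerary f \<xi> n x)) \<in> borel_measurable borel"
  by (rule measurable_compose[OF itinerary_measurable]) simp

end

locale coding_measure = coding f \<xi> A
  for f :: "'a::metric_space \<Rightarrow> 'a" and \<xi> :: "'a \<Rightarrow> 'b" and A +
  fixes \<mu> :: "'a measure"
  assumes invariant: "\<mu> \<in> invariant_measures f"
begin

sublocale prob_space \<mu>
  by (rule invariant_measuresD(1)[OF invariant])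

lemma sets_mu [simp, measurable_cong]: "sets \<mu> = sets borel"
  by (rule invariant_measuresD(2)[OF invariant])

lemma space_mu [simp]: "space \<mu> = UNIV"
  by (rule invariant_measuresD(3)[OF invariant])

lemma measurable_mu: "measurable \<mu> N = measurable borel N"
  by (rule measurable_cong_sets) auto

definition word_prob :: "'b list \<Rightarrow> real" where
  "word_prob w = measure \<mu> (itinerary f \<xi> (length w) -` {w})"

definition block_entropy :: "nat \<Rightarrow> real" where
  "block_entropy n = (\<Sum>w\<in>words A n. - (word_prob w * ln (word_prob w)))"

lemma word_prob_nonneg [simp]: "0 \<le> word_prob w"
  by (simp add: word_prob_def)

lemma word_prob_le_1: "word_prob w \<le> 1"
  by (simp add: word_prob_def)

lemma block_entropy_nonneg: "0 \<le> block_entropy n"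
  unfolding block_entropy_def
proof (rule sum_nonneg)
  fix w
  have "ln (word_prob w) \<le> 0"
    using word_prob_le_1[of w] word_prob_nonneg[of w]
    by (metis ln_0 ln_le_zero_iff order_le_less order_refl)
  then show "0 \<le> - (word_prob w * ln (word_prob w))"
    using word_prob_nonneg[of w] by (simp add: mult_nonneg_nonpos)
qed

lemma integral_itinerary:
  "(LINT x|\<mu>. g (itinerary f \<xi> n x)) = (\<Sum>w\<in>words A n. word_prob w * g w)" for g :: "'b list \<Rightarrow> real"
proof -
  have "g (itinerary f \<xi> n x) = (\<Sum>w\<in>words A n. indicator (itinerary f \<xi> n -` {w}) x * g w)" for x
  proof -
    have "(\<Sum>w\<in>words A n. indicator (itinerary f \<xi> n -` {w}) x * g w)
      = (\<Sum>w\<in>words A n. if itinerary f \<xi> n x = w then g w else 0)"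
      by (intro sum.cong) (auto simp: indicator_def)
    then show ?thesis using itinerary_in[of n x] finite_words[OF finite_A] by simp
  qed
  then have "(LINT x|\<mu>. g (itinerary f \<xi> n x))
    = (LINT x|\<mu>. (\<Sum>w\<in>words A n. indicator (itinerary f \<xi> n -` {w}) x * g w))"
    by simp
  also have "\<dots> = (\<Sum>w\<in>words A n. (LINT x|\<mu>. indicator (itinerary f \<xi> n -` {w}) x * g w))"
    by (intro Bochner_Integration.integral_sum integrable_mult_left integrable_real_indicator)
      (auto simp: itinerary_borel less_top[symmetric])
  also have "\<dots> = (\<Sum>w\<in>words A n. word_prob w * g w)"
    by (intro sum.cong) (auto simp: word_prob_def words_def)
  finally show ?thesis .
qed

lemma integrable_itinerary: "integrable \<mu> (\<lambda>x. g (itinerary f \<xi> n x) :: real)"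
proof (rule integrable_const_bound[of _ "\<Sum>w\<in>words A n. \<bar>g w\<bar>"])
  show "AE x in \<mu>. norm (g (itinerary f \<xi> n x)) \<le> (\<Sum>w\<in>words A n. \<bar>g w\<bar>)"
    by (intro AE_I2) (auto intro!: member_le_sum itinerary_in finite_words finite_A)
qed (simp add: measurable_mu itinerary_fun_borel)

lemma sum_word_prob: "(\<Sum>w\<in>words A n. word_prob w) = 1"
  using integral_itinerary[of "\<lambda>_. 1" n] prob_space by simp

lemma block_entropy_eq_integral:
  "block_entropy n = (LINT x|\<mu>. - ln (word_prob (itinerary f \<xi> n x)))"
  unfolding integral_itinerary[of "\<lambda>w. - ln (word_prob w)"] block_entropy_def by simp

text \<open>Gibbs' inequality with the word distribution as \<open>p\<close> and
  \<open>- ln q\<close> read as a code length. This is where weights built from covers meet the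
  measure.\<close>

lemma block_entropy_le_integral:
  assumes pos: "\<And>w. w \<in> words A n \<Longrightarrow> 0 < q w" and "(\<Sum>w\<in>words A n. q w) \<le> 1"
    and "integrable \<mu> g" and "\<And>x. - ln (q (itinerary f \<xi> n x)) \<le> g x"
  shows "block_entropy n \<le> (LINT x|\<mu>. g x)"
proof -
  have "block_entropy n \<le> (\<Sum>w\<in>words A n. - (word_prob w * ln (q w)))"
    unfolding block_entropy_def
    by (rule gibbs_inequality) (use assms in \<open>auto simp: finite_words finite_A sum_word_prob less_imp_le\<close>)
  also have "\<dots> = (LINT x|\<mu>. - ln (q (itinerary f \<xi> n x)))"
    unfolding integral_itinerary[of "\<lambda>w. - ln (q w)"] by simp
  also have "\<dots> \<le> (LINT x|\<mu>. g x)"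
    by (intro integral_mono integrable_itinerary[of "\<lambda>w. - ln (q w)"] assms)
  finally show ?thesis .
qed

text \<open>The cylinder of \<open>u @ v\<close> is the cylinder of \<open>u\<close> cut with a
  preimage of the cylinder of \<open>v\<close>. The bounds make the product of the two probabilities
  positive wherever the joint one is, as Gibbs' inequality demands.\<close>

lemma word_prob_append_le:
  "word_prob (u @ v) \<le> word_prob u" "word_prob (u @ v) \<le> word_prob v"
proof -
  let ?m = "length u" and ?n = "length v"
  have eq: "itinerary f \<xi> (length (u @ v)) -` {u @ v}
    = itinerary f \<xi> ?m -` {u} \<inter> (f ^^ ?m) -` (itinerary f \<xi> ?n -` {v})"
    by (auto simp: itinerary_add)
  have meas: "(f ^^ ?m) -` (itinerary f \<xi> ?n -` {v}) \<in> sets borel"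
    using measurable_sets[OF funpow_borel itinerary_borel] by simp
  show "word_prob (u @ v) \<le> word_prob u"
    unfolding word_prob_def eq by (rule finite_measure_mono) (auto simp: itinerary_borel)
  have "word_prob (u @ v) \<le> measure \<mu> ((f ^^ ?m) -` (itinerary f \<xi> ?n -` {v}))"
    unfolding word_prob_def eq by (rule finite_measure_mono) (auto simp: meas)
  then show "word_prob (u @ v) \<le> word_prob v"
    by (simp add: word_prob_def measure_vimage_funpow[OF invariant itinerary_borel])
qed

text \<open>Gibbs' inequality against the product of the two marginals: the logarithm splits the
  cost in two, and invariance removes the shift by \<open>m\<close> from the second part.\<close>

lemma block_entropy_subadditive: "block_entropy (m + n) \<le> block_entropy m + block_entropy n"
proof -
  let ?q = "\<lambda>w. word_prob (take m w) * word_prob (drop m w)"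
  have "block_entropy (m + n) \<le> (\<Sum>w\<in>words A (m + n). - (word_prob w * ln (?q w)))"
    unfolding block_entropy_def
  proof (rule gibbs_inequality)
    fix w assume "0 < word_prob w"
    then show "0 < ?q w"
      using word_prob_append_le[of "take m w" "drop m w"] by (intro mult_pos_pos) auto
  next
    have "(\<Sum>w\<in>words A (m + n). ?q w) = (\<Sum>u\<in>words A m. \<Sum>v\<in>words A n. word_prob u * word_prob v)"
      unfolding sum_words_add by (intro sum.cong refl) (auto simp: words_def)
    also have "\<dots> = 1" by (simp add: sum_word_prob flip: sum_product)
    finally show "(\<Sum>w\<in>words A (m + n). ?q w) \<le> (\<Sum>w\<in>words A (m + n). word_prob w)"
      by (simp add: sum_word_prob)
  qed (auto simp: finite_words finite_A)
  also have "\<dots> = (\<Sum>w\<in>words A (m + n). word_prob w * (- ln (word_prob (take m w)) - ln (word_prob (drop m w))))"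
  proof (intro sum.cong refl)
    fix w
    show "- (word_prob w * ln (?q w)) = word_prob w * (- ln (word_prob (take m w)) - ln (word_prob (drop m w)))"
    proof (cases "word_prob w = 0")
      case False
      then have "0 < word_prob w" using word_prob_nonneg[of w] by linarith
      then have "0 < word_prob (take m w)" "0 < word_prob (drop m w)"
        using word_prob_append_le[of "take m w" "drop m w"] by auto
      then show ?thesis by (simp add: ln_mult algebra_simps)
    qed simp
  qed
  also have "\<dots> = (LINT x|\<mu>. - ln (word_prob (take m (itinerary f \<xi> (m + n) x)))
                               - ln (word_prob (drop m (itinerary f \<xi> (m + n) x))))"
    by (rule integral_itinerary[symmetric])
  also have "\<dots> = (LINT x|\<mu>. - ln (word_prob (itinerary f \<xi> m x)) + - ln (word_prob (itinerary f \<xi> n ((f ^^ m) x))))"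
    by (simp add: itinerary_add)
  also have "\<dots> = (LINT x|\<mu>. - ln (word_prob (itinerary f \<xi> m x)))
      + (LINT x|\<mu>. - ln (word_prob (itinerary f \<xi> n ((f ^^ m) x))))"
  proof (rule Bochner_Integration.integral_add)
    show "integrable \<mu> (\<lambda>x. - ln (word_prob (itinerary f \<xi> m x)))"
      by (rule integrable_itinerary)
    show "integrable \<mu> (\<lambda>x. - ln (word_prob (itinerary f \<xi> n ((f ^^ m) x))))"
      using integrable_itinerary[of "\<lambda>w. - ln (word_prob (drop m w))" "m + n"]
      by (simp add: itinerary_add)
  qed
  also have "\<dots> = block_entropy m + block_entropy n"
    using integral_funpow[OF invariant itinerary_fun_borel[of "\<lambda>w. - ln (word_prob w)" n], of m]
    by (simp only: block_entropy_eq_integral)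
  finally show ?thesis .
qed

definition entropy_rate :: real where
  "entropy_rate = lim (\<lambda>n. block_entropy n / real n)"

lemma entropy_rate_LIMSEQ: "(\<lambda>n. block_entropy n / real n) \<longlonglongrightarrow> entropy_rate"
  using fekete[of block_entropy, OF block_entropy_subadditive block_entropy_nonneg]
  by (simp add: entropy_rate_def convergent_LIMSEQ_iff)

end

section \<open>Partitions and covers by Bowen balls\<close>

definition cell :: "'a set set \<Rightarrow> 'a \<Rightarrow> 'a set" where
  "cell P x = (THE C. C \<in> P \<and> x \<in> C)"

lemma cell_eqI:
  assumes "partition_on UNIV P" "C \<in> P" "x \<in> C" shows "cell P x = C"
  unfolding cell_def
  by (rule the_equality) (use assms in \<open>auto simp: partition_on_def disjoint_def\<close>)

lemma cell_in:
  assumes "partition_on UNIV P" shows "cell P x \<in> P" "x \<in> cell P x"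
proof -
  obtain C where "C \<in> P" "x \<in> C" using assms by (auto simp: partition_on_def)
  with cell_eqI[OF assms this] show "cell P x \<in> P" "x \<in> cell P x" by auto
qed

lemma cell_eq_iff:
  assumes "partition_on UNIV P" "C \<in> P" shows "cell P x = C \<longleftrightarrow> x \<in> C"
  using cell_eqI[OF assms] cell_in[OF assms(1)] by blast

lemma coding_cell:
  assumes "f \<in> borel_measurable borel" "finite P" "P \<subseteq> sets borel" "partition_on UNIV P"
  shows "coding f (cell P) P"
proof
  show "cell P -` {C} \<in> sets borel" if "C \<in> P" for C
  proof -
    have "cell P -` {C} = C" using cell_eq_iff[OF assms(4) that] by auto
    then show ?thesis using that assms by auto
  qed
qed (use assms cell_in in auto)

lemma coding_measure_cell:
  assumes "\<mu> \<in> invariant_measures f" "finite P" "P \<subseteq> sets borel" "partition_on UNIV P"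
  shows "coding_measure f (cell P) P \<mu>"
  by (intro coding_measure.intro coding_cell coding_measure_axioms.intro invariant_measuresD(6)[OF assms(1)] assms)

text \<open>Choice functions that agree below \<open>n\<close> define the same word, and the
  intersection in the join is the cylinder of that word.\<close>

lemma iterated_join_eq:
  assumes sp: "space \<mu> = UNIV" and P: "partition_on UNIV P"
  shows "iterated_join \<mu> f P n = (\<lambda>w. itinerary f (cell P) n -` {w}) ` words P n - {{}}"
proof -
  have *: "(\<Inter>i<n. (f ^^ i) -` c i) = itinerary f (cell P) n -` {map c [0..<n]}"
    if "\<forall>i<n. c i \<in> P" for c
    using that by (auto simp: list_eq_iff_nth_eq cell_eq_iff[OF P])
  have **: "\<exists>c. (\<forall>i<n. c i \<in> P) \<and> w = map c [0..<n]" if "w \<in> words P n" for w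
    using that by (intro exI[of _ "\<lambda>i. w ! i"]) (auto simp: words_def list_eq_iff_nth_eq)
  have "{(\<Inter>i<n. (f ^^ i) -` c i) \<inter> space \<mu> | c. \<forall>i<n. c i \<in> P}
      = (\<lambda>w. itinerary f (cell P) n -` {w}) ` words P n" (is "?L = ?R")
  proof
    show "?L \<subseteq> ?R"
    proof
      fix X assume "X \<in> ?L"
      then obtain c where c: "\<forall>i<n. c i \<in> P" "X = (\<Inter>i<n. (f ^^ i) -` c i)" by (auto simp: sp)
      then have "map c [0..<n] \<in> words P n" by (auto simp: words_def)
      then show "X \<in> ?R" using c * by blast
    qed
    show "?R \<subseteq> ?L"
    proof
      fix X assume "X \<in> ?R"
      then obtain w where w: "w \<in> words P n" "X = itinerary f (cell P) n -` {w}" by auto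
      from **[OF w(1)] obtain c where c: "\<forall>i<n. c i \<in> P" "w = map c [0..<n]" by auto
      have "X = (\<Inter>i<n. (f ^^ i) -` c i) \<inter> space \<mu>" using *[OF c(1)] w c sp by simp
      then show "X \<in> ?L" using c by blast
    qed
  qed
  then show ?thesis unfolding iterated_join_def by simp
qed

text \<open>Distinct words have disjoint cylinders, so the words with non-empty cylinder correspond
  one to one to the elements of the join. The remaining words contribute
  \<open>0 * ln 0 = 0\<close>.\<close>

lemma (in coding_measure) partition_entropy_itinerary:
  "partition_entropy \<mu> ((\<lambda>w. itinerary f \<xi> n -` {w}) ` words A n - {{}}) = block_entropy n"
proof -
  let ?c = "\<lambda>w. itinerary f \<xi> n -` {w}" and ?W = "{w \<in> words A n. itinerary f \<xi> n -` {w} \<noteq> {}}"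
  have im: "?c ` words A n - {{}} = ?c ` ?W" by auto
  have inj: "inj_on ?c ?W" by (rule inj_onI) auto
  have "partition_entropy \<mu> (?c ` words A n - {{}}) = - (\<Sum>w\<in>?W. measure \<mu> (?c w) * ln (measure \<mu> (?c w)))"
    unfolding partition_entropy_def im sum.reindex[OF inj] by simp
  also have "\<dots> = - (\<Sum>w\<in>words A n. measure \<mu> (?c w) * ln (measure \<mu> (?c w)))"
    by (intro arg_cong[of _ _ uminus] sum.mono_neutral_left finite_words finite_A) auto
  also have "\<dots> = block_entropy n"
    unfolding block_entropy_def sum_negf
    by (intro arg_cong[of _ _ uminus] sum.cong refl) (auto simp: word_prob_def words_def)
  finally show ?thesis .
qed

lemma entropy_wrt_partition_eq:
  assumes "\<mu> \<in> invariant_measures f" "finite P" "P \<subseteq> sets borel" "partition_on UNIV P"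
  shows "entropy_wrt_partition \<mu> f P = coding_measure.entropy_rate f (cell P) P \<mu>"
proof -
  interpret coding_measure f "cell P" P \<mu> by (rule coding_measure_cell[OF assms])
  show ?thesis
    unfolding entropy_wrt_partition_def entropy_rate_def
      iterated_join_eq[OF space_mu assms(4)] partition_entropy_itinerary ..
qed

section \<open>Monotonicity of cover sums in the scale and in the least length\<close>

lemma bowen_ball_mono: "\<epsilon> \<le> \<epsilon>' \<Longrightarrow> bowen_ball f n x \<epsilon> \<subseteq> bowen_ball f n x \<epsilon>'"
  by (force simp: bowen_ball_def)

lemma cover_sum_antimono_scale:
  assumes "\<epsilon> \<le> \<epsilon>'" shows "cover_sum f Z \<alpha> N \<epsilon>' \<le> cover_sum f Z \<alpha> N \<epsilon>"
  unfolding cover_sum_def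
proof (rule Inf_superset_mono, rule Collect_mono, rule impI, elim exE conjE, intro exI conjI)
  fix s and I :: "nat set" and x n assume "Z \<subseteq> (\<Union>i\<in>I. bowen_ball f (n i) (x i) \<epsilon>)"
  also have "\<dots> \<subseteq> (\<Union>i\<in>I. bowen_ball f (n i) (x i) \<epsilon>')"
    by (intro UN_mono bowen_ball_mono assms order_refl)
  finally show "Z \<subseteq> (\<Union>i\<in>I. bowen_ball f (n i) (x i) \<epsilon>')" .
qed

lemma cover_sum_mono_length:
  assumes "M \<le> N" shows "cover_sum f Z \<alpha> M \<epsilon> \<le> cover_sum f Z \<alpha> N \<epsilon>"
  unfolding cover_sum_def
proof (rule Inf_superset_mono, rule Collect_mono, rule impI, elim exE conjE, intro exI conjI)
  fix s and I :: "nat set" and x :: "nat \<Rightarrow> 'a" and n assume "\<forall>i\<in>I. N \<le> n i"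
  then show "\<forall>i\<in>I. M \<le> n i" using assms by (auto intro: order_trans)
qed

lemma cover_limit_eq_SUP: "cover_limit f Z \<alpha> \<epsilon> = (SUP N. cover_sum f Z \<alpha> N \<epsilon>)"
  unfolding cover_limit_def
  by (intro limI LIMSEQ_SUP monoI cover_sum_mono_length)

text \<open>Cover sums increase with \<open>N\<close>, so a vanishing limit forces all of them to
  vanish. Null sets can then be handled at a fixed \<open>N\<close>.\<close>

lemma cover_limit_eq_0_iff: "cover_limit f Z \<alpha> \<epsilon> = 0 \<longleftrightarrow> (\<forall>N. cover_sum f Z \<alpha> N \<epsilon> = 0)"
  unfolding cover_limit_eq_SUP SUP_eq_iff bot_ennreal[symmetric] SUP_bot_conv by simp

lemma set_pressure_antimono:
  assumes "\<epsilon> \<le> \<epsilon>'" shows "set_pressure f Z \<epsilon>' \<le> set_pressure f Z \<epsilon>"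
proof -
  have *: "cover_sum f Z \<alpha> N \<epsilon>' = 0" if "cover_sum f Z \<alpha> N \<epsilon> = 0" for \<alpha> N
    using cover_sum_antimono_scale[OF assms, of f Z \<alpha> N] that by simp
  show ?thesis
    unfolding set_pressure_def cover_limit_eq_0_iff
    by (rule Inf_superset_mono) (auto intro: *)
qed

lemma measure_pressure_at_antimono:
  assumes "\<epsilon> \<le> \<epsilon>'" shows "measure_pressure_at f \<mu> \<epsilon>' \<le> measure_pressure_at f \<mu> \<epsilon>"
  unfolding measure_pressure_at_def
proof (rule Inf_mono)
  fix b assume "b \<in> {set_pressure f Z \<epsilon> |Z. Z \<in> sets \<mu> \<and> emeasure \<mu> Z = 1}"
  then obtain Z where Z: "b = set_pressure f Z \<epsilon>" "Z \<in> sets \<mu> \<and> emeasure \<mu> Z = 1" by (elim CollectE exE conjE) (rule that, simp_all only:)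
  show "\<exists>a\<in>{set_pressure f Z \<epsilon>' |Z. Z \<in> sets \<mu> \<and> emeasure \<mu> Z = 1}. a \<le> b"
  proof (rule bexI)
    show "set_pressure f Z \<epsilon>' \<le> b" unfolding Z(1) by (rule set_pressure_antimono[OF assms])
    show "set_pressure f Z \<epsilon>' \<in> {set_pressure f Z \<epsilon>' |Z. Z \<in> sets \<mu> \<and> emeasure \<mu> Z = 1}"
      by (rule CollectI, rule exI[of _ Z], rule conjI[OF refl Z(2)])
  qed
qed

text \<open>A smaller scale only raises the pressure, so the one-sided limit exists and is a
  supremum.\<close>

lemma measure_pressure_eq_SUP: "measure_pressure f \<mu> = (SUP \<epsilon>\<in>{0<..}. measure_pressure_at f \<mu> \<epsilon>)"
proof -
  let ?p = "measure_pressure_at f \<mu>" and ?s = "SUP \<epsilon>\<in>{0<..}. measure_pressure_at f \<mu> \<epsilon>"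
  have "(?p \<longlongrightarrow> ?s) (at_right 0)"
  proof (rule order_tendstoI)
    fix a assume "a < ?s"
    then obtain e where e: "0 < e" "a < ?p e" by (auto simp: less_SUP_iff)
    show "\<forall>\<^sub>F \<epsilon> in at_right 0. a < ?p \<epsilon>"
      unfolding eventually_at_right_field
      using e measure_pressure_at_antimono[of _ e f \<mu>] by (intro exI[of _ e]) (auto intro: less_le_trans less_imp_le)
  next
    fix a assume a: "?s < a"
    show "\<forall>\<^sub>F \<epsilon> in at_right 0. ?p \<epsilon> < a"
      using eventually_at_right_less by (rule eventually_mono) (auto intro!: le_less_trans[OF SUP_upper a])
  qed
  then show ?thesis
    unfolding measure_pressure_def by (rule tendsto_Lim[rotated]) simp
qed

section \<open>Countable covers and unions of sets with vanishing cover sum\<close>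

lemma infsum_ennreal_le:
  fixes g :: "'i \<Rightarrow> ennreal"
  assumes "\<And>F. finite F \<Longrightarrow> F \<subseteq> I \<Longrightarrow> sum g F \<le> b"
  shows "infsum g I \<le> b"
  by (rule infsum_le_finite_sums[OF nonneg_summable_on_complete]) (simp, rule assms)

lemma sum_le_infsum_ennreal:
  fixes g :: "'i \<Rightarrow> ennreal"
  assumes "finite F" "F \<subseteq> I"
  shows "sum g F \<le> infsum g I"
  unfolding infsum_finite[OF assms(1), symmetric]
  by (rule infsum_mono_neutral) (use assms in \<open>auto intro: nonneg_summable_on_complete\<close>)

lemma cover_sum_lessE:
  assumes "cover_sum f Z \<alpha> N \<epsilon> < b"
  obtains I :: "nat set" and x n where "Z \<subseteq> (\<Union>i\<in>I. bowen_ball f (n i) (x i) \<epsilon>)"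
    "\<And>i. i \<in> I \<Longrightarrow> N \<le> n i" "(\<Sum>\<^sub>\<infinity>i\<in>I. ennreal (exp (- \<alpha> * real (n i)))) < b"
proof -
  define S where "S = {(\<Sum>\<^sub>\<infinity>i\<in>I. ennreal (exp (- \<alpha> * real (n i)))) | (I :: nat set) (x :: nat \<Rightarrow> 'a) n.
      Z \<subseteq> (\<Union>i\<in>I. bowen_ball f (n i) (x i) \<epsilon>) \<and> (\<forall>i\<in>I. N \<le> n i)}"
  have "Inf S < b" using assms by (simp add: cover_sum_def S_def)
  then obtain s where "s \<in> S" "s < b" by (auto simp: Inf_less_iff)
  from \<open>s \<in> S\<close> obtain I :: "nat set" and x :: "nat \<Rightarrow> 'a" and n
    where *: "s = (\<Sum>\<^sub>\<infinity>i\<in>I. ennreal (exp (- \<alpha> * real (n i))))"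
      "Z \<subseteq> (\<Union>i\<in>I. bowen_ball f (n i) (x i) \<epsilon>)" "\<forall>i\<in>I. N \<le> n i"
    unfolding S_def mem_Collect_eq by metis
  show thesis
  proof (rule that)
    show "Z \<subseteq> (\<Union>i\<in>I. bowen_ball f (n i) (x i) \<epsilon>)" by (rule *(2))
    show "N \<le> n i" if "i \<in> I" for i using *(3) that by blast
    show "(\<Sum>\<^sub>\<infinity>i\<in>I. ennreal (exp (- \<alpha> * real (n i)))) < b"
      using \<open>s < b\<close> by (simp only: *(1))
  qed
qed

text \<open>Moves a cover indexed by any countable set, such as a set of pairs, to the sets of
  natural numbers used in \<open>cover_sum\<close>. The cost is tested on finite subfamilies, where
  sums can be rearranged freely.\<close>

lemma cover_sum_le:
  fixes x :: "'i \<Rightarrow> 'a::metric_space" and b :: ennreal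
  assumes J: "countable J" and Z: "Z \<subseteq> (\<Union>j\<in>J. bowen_ball f (n j) (x j) \<epsilon>)"
    and N: "\<And>j. j \<in> J \<Longrightarrow> N \<le> n j"
    and b: "\<And>F. finite F \<Longrightarrow> F \<subseteq> J \<Longrightarrow> (\<Sum>j\<in>F. ennreal (exp (- \<alpha> * real (n j)))) \<le> b"
  shows "cover_sum f Z \<alpha> N \<epsilon> \<le> b"
proof -
  let ?I = "to_nat_on J ` J" and ?h = "from_nat_into J"
  have inj: "inj_on (to_nat_on J) J" using J by (rule inj_on_to_nat_on)
  have h: "?h (to_nat_on J j) = j" if "j \<in> J" for j using J that by simp
  have "cover_sum f Z \<alpha> N \<epsilon> \<le> (\<Sum>\<^sub>\<infinity>i\<in>?I. ennreal (exp (- \<alpha> * real ((n \<circ> ?h) i))))"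
    unfolding cover_sum_def
  proof (rule Inf_lower, rule CollectI, intro exI conjI)
    show "Z \<subseteq> (\<Union>i\<in>?I. bowen_ball f ((n \<circ> ?h) i) ((x \<circ> ?h) i) \<epsilon>)"
      using Z h by fastforce
    show "\<forall>i\<in>?I. N \<le> (n \<circ> ?h) i" using N h by auto
  qed (rule refl)
  also have "\<dots> = (\<Sum>\<^sub>\<infinity>j\<in>J. ennreal (exp (- \<alpha> * real (n j))))"
    unfolding infsum_reindex[OF inj] by (rule infsum_cong) (simp add: h)
  also have "\<dots> \<le> b" by (rule infsum_ennreal_le) (rule b)
  finally show ?thesis .
qed

text \<open>The usual argument for outer measures: \<open>Z j\<close> receives a cover of cost below
  e / 2^(j + 1), and the combined cover is indexed by pairs.\<close>

lemma cover_sum_UN_eq_0: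
  fixes Z :: "nat \<Rightarrow> 'a::metric_space set"
  assumes "\<And>j. cover_sum f (Z j) \<alpha> N \<epsilon> = 0"
  shows "cover_sum f (\<Union>j. Z j) \<alpha> N \<epsilon> = 0"
proof -
  let ?t = "\<lambda>n::nat. exp (- \<alpha> * real n)"
  have "cover_sum f (\<Union>j. Z j) \<alpha> N \<epsilon> \<le> 0 + ennreal e" if e: "0 < e" for e :: real
  proof -
    define good where "good j I x n \<longleftrightarrow> Z j \<subseteq> (\<Union>i\<in>I. bowen_ball f (n i) (x i) \<epsilon>) \<and> (\<forall>i\<in>I. N \<le> n i)
        \<and> (\<Sum>\<^sub>\<infinity>i\<in>I. ennreal (?t (n i))) < ennreal (e / 2 ^ Suc j)" for j and I :: "nat set" and x n
    have "\<exists>I x n. good j I x n" for j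
    proof -
      have "cover_sum f (Z j) \<alpha> N \<epsilon> < ennreal (e / 2 ^ Suc j)" using assms e by simp
      then obtain I :: "nat set" and x n where g: "Z j \<subseteq> (\<Union>i\<in>I. bowen_ball f (n i) (x i) \<epsilon>)"
        "\<And>i. i \<in> I \<Longrightarrow> N \<le> n i" "(\<Sum>\<^sub>\<infinity>i\<in>I. ennreal (?t (n i))) < ennreal (e / 2 ^ Suc j)"
        by (rule cover_sum_lessE) (rule that)
      have "good j I x n" unfolding good_def using g by (intro conjI ballI)
      then show ?thesis by (intro exI)
    qed
    then obtain I x n where good: "\<And>j. good j (I j) (x j) (n j)" by metis
    have *: "\<And>j. Z j \<subseteq> (\<Union>i\<in>I j. bowen_ball f (n j i) (x j i) \<epsilon>)"
      "\<And>j i. i \<in> I j \<Longrightarrow> N \<le> n j i"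
      "\<And>j. (\<Sum>\<^sub>\<infinity>i\<in>I j. ennreal (?t (n j i))) < ennreal (e / 2 ^ Suc j)"
      by (rule good[unfolded good_def, THEN conjunct1], rule good[unfolded good_def, THEN conjunct2, THEN conjunct1, THEN bspec], assumption, rule good[unfolded good_def, THEN conjunct2, THEN conjunct2])
    have "cover_sum f (\<Union>j. Z j) \<alpha> N \<epsilon> \<le> ennreal e"
    proof (rule cover_sum_le[where J = "Sigma UNIV I" and n = "\<lambda>(j, i). n j i" and x = "\<lambda>(j, i). x j i"])
      show "(\<Union>j. Z j) \<subseteq> (\<Union>p\<in>Sigma UNIV I. bowen_ball f (case p of (j, i) \<Rightarrow> n j i) (case p of (j, i) \<Rightarrow> x j i) \<epsilon>)"
        using *(1) by fastforce
      fix F :: "(nat \<times> nat) set" assume F: "finite F" "F \<subseteq> Sigma UNIV I"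
      obtain M where M: "fst ` F \<subseteq> {..<M}"
        using F(1) by (metis finite_imageI finite_nat_iff_bounded)
      define G where "G j = {i. (j, i) \<in> F}" for j
      have G: "finite (G j)" "G j \<subseteq> I j" for j
      proof -
        have "G j = snd ` (F \<inter> {j} \<times> UNIV)" by (force simp: G_def)
        then show "finite (G j)" using F by simp
        show "G j \<subseteq> I j" using F by (auto simp: G_def)
      qed
      have FG: "F = Sigma {..<M} G" using M by (force simp: G_def)
      have "(\<Sum>p\<in>F. ennreal (?t (case p of (j, i) \<Rightarrow> n j i))) = (\<Sum>j<M. \<Sum>i\<in>G j. ennreal (?t (n j i)))"
        unfolding FG by (subst sum.Sigma) (auto simp: G simp del: sum_ennreal intro!: sum.cong)
      also have "\<dots> \<le> (\<Sum>j<M. ennreal (e / 2 ^ Suc j))"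
      proof (rule sum_mono)
        fix j
        have "(\<Sum>i\<in>G j. ennreal (?t (n j i))) \<le> (\<Sum>\<^sub>\<infinity>i\<in>I j. ennreal (?t (n j i)))"
          by (rule sum_le_infsum_ennreal[OF G])
        then show "(\<Sum>i\<in>G j. ennreal (?t (n j i))) \<le> ennreal (e / 2 ^ Suc j)"
          using *(3)[of j] by (simp add: order_trans less_imp_le)
      qed
      also have "\<dots> = ennreal (\<Sum>j<M. e / 2 ^ Suc j)" using e by (subst sum_ennreal) auto
      also have "(\<Sum>j<M. e / 2 ^ Suc j) = e * (1 - 1 / 2 ^ M)"
        by (induction M) (auto simp: field_simps)
      also have "\<dots> \<le> e" using e by simp
      finally show "(\<Sum>p\<in>F. ennreal (?t (case p of (j, i) \<Rightarrow> n j i))) \<le> ennreal e"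
        using e by (simp add: ennreal_leI)
    qed (use *(2) in auto)
    then show ?thesis by simp
  qed
  then show ?thesis by (metis ennreal_le_epsilon le_zero_eq)
qed

lemma cover_sum_countable_UN_eq_0:
  assumes "countable T" "\<And>t. t \<in> T \<Longrightarrow> cover_sum f (Z t) \<alpha> N \<epsilon> = 0"
  shows "cover_sum f (\<Union>t\<in>T. Z t) \<alpha> N \<epsilon> = 0"
proof (cases "T = {}")
  case True
  have "cover_sum f {} \<alpha> N \<epsilon> \<le> 0"
    by (rule cover_sum_le[where J = "{}"]) auto
  then show ?thesis using True by simp
next
  case False
  have "cover_sum f (\<Union>j. Z (from_nat_into T j)) \<alpha> N \<epsilon> = 0"
    by (rule cover_sum_UN_eq_0) (rule assms(2)[OF from_nat_into[OF False]])
  then show ?thesis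
    using range_from_nat_into[OF False assms(1)] by (metis image_image)
qed

section \<open>The upper bound by low-cost words\<close>

text \<open>Borel--Cantelli for covers: for every \<open>M\<close> the balls of all lengths n \<ge>
  M cover the set, at the cost of the tail of a geometric series. The gap between \<alpha> and
  \<beta> supplies a ratio below 1.\<close>

lemma cover_sum_infinitely_often_eq_0:
  fixes F :: "nat \<Rightarrow> 'a::metric_space set"
  assumes F: "\<And>n. finite (F n)" "\<And>n. real (card (F n)) \<le> c * exp (\<alpha> * real n)"
    and Y: "\<And>n. Y n \<subseteq> (\<Union>x\<in>F n. bowen_ball f n x \<epsilon>)" and "\<alpha> < \<beta>"
  shows "cover_sum f {x. \<exists>\<^sub>\<infinity>n. x \<in> Y n} \<beta> N \<epsilon> = 0"
proof -
  define r where "r = exp (\<alpha> - \<beta>)"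
  have r: "0 < r" "r < 1" using \<open>\<alpha> < \<beta>\<close> by (auto simp: r_def)
  have "0 \<le> c" using F(2)[of 0] by (simp add: order_trans[OF of_nat_0_le_iff])
  have rn: "exp (\<alpha> * real n) * exp (- \<beta> * real n) = r ^ n" for n
    by (simp add: r_def mult_exp_exp algebra_simps flip: exp_of_nat_mult)
  have bound: "cover_sum f {x. \<exists>\<^sub>\<infinity>n. x \<in> Y n} \<beta> M \<epsilon> \<le> ennreal (c * (r ^ M / (1 - r)))" for M
  proof (rule cover_sum_le[where J = "Sigma {M..} F" and n = fst and x = snd])
    show "countable (Sigma {M..} F)"
      using F(1) by (intro countable_SIGMA) (auto intro: countable_finite)
    show "{x. \<exists>\<^sub>\<infinity>n. x \<in> Y n} \<subseteq> (\<Union>j\<in>Sigma {M..} F. bowen_ball f (fst j) (snd j) \<epsilon>)"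
    proof
      fix x assume "x \<in> {x. \<exists>\<^sub>\<infinity>n. x \<in> Y n}"
      then obtain n where "M \<le> n" "x \<in> Y n" by (auto simp: INFM_nat_le)
      with Y[of n] show "x \<in> (\<Union>j\<in>Sigma {M..} F. bowen_ball f (fst j) (snd j) \<epsilon>)" by fastforce
    qed
    fix G assume G: "finite G" "G \<subseteq> Sigma {M..} F"
    obtain L where L: "fst ` G \<subseteq> {..<L}"
      using G(1) by (metis finite_imageI finite_nat_iff_bounded)
    have sub: "G \<subseteq> Sigma {M..<L} F" using G L by fastforce
    have "(\<Sum>j\<in>G. exp (- \<beta> * real (fst j))) \<le> (\<Sum>j\<in>Sigma {M..<L} F. exp (- \<beta> * real (fst j)))"
      by (rule sum_mono2) (use sub F(1) in auto)
    also have "\<dots> = (\<Sum>n\<in>{M..<L}. real (card (F n)) * exp (- \<beta> * real n))"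
      using sum.Sigma[of "{M..<L}" F "\<lambda>n x. exp (- \<beta> * real n)"] F(1) by (simp add: case_prod_unfold)
    also have "\<dots> \<le> (\<Sum>n\<in>{M..<L}. c * r ^ n)"
    proof (rule sum_mono)
      fix n
      have "real (card (F n)) * exp (- \<beta> * real n) \<le> (c * exp (\<alpha> * real n)) * exp (- \<beta> * real n)"
        by (rule mult_right_mono[OF F(2)]) simp
      then show "real (card (F n)) * exp (- \<beta> * real n) \<le> c * r ^ n"
        by (simp only: mult.assoc rn)
    qed
    also have "\<dots> \<le> c * (r ^ M / (1 - r))"
    proof -
      have "(\<Sum>n\<in>{M..<L}. r ^ n) \<le> r ^ M / (1 - r)"
      proof (cases "M < L")
        case True
        have "(\<Sum>n\<in>{M..<L}. r ^ n) = (\<Sum>n\<in>{M..<L}. - (r ^ Suc n) / (1 - r) - - (r ^ n) / (1 - r))"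
        proof (intro sum.cong refl)
          fix n
          have "r ^ n = r ^ n * (1 - r) / (1 - r)" using r by simp
          then show "r ^ n = - (r ^ Suc n) / (1 - r) - - (r ^ n) / (1 - r)"
            by (simp add: algebra_simps flip: diff_divide_distrib)
        qed
        also have "\<dots> = - (r ^ L) / (1 - r) - - (r ^ M) / (1 - r)"
          by (rule sum_Suc_diff') (use True in simp)
        also have "\<dots> \<le> r ^ M / (1 - r)" using r by simp
        finally show ?thesis .
      qed (use r in auto)
      then show ?thesis unfolding sum_distrib_left[symmetric] using \<open>0 \<le> c\<close> by (rule mult_left_mono)
    qed
    finally show "(\<Sum>j\<in>G. ennreal (exp (- \<beta> * real (fst j)))) \<le> ennreal (c * (r ^ M / (1 - r)))"
      by (subst sum_ennreal) (auto intro: ennreal_leI)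
  qed auto
  have lim: "(\<lambda>M. ennreal (c * (r ^ M / (1 - r)))) \<longlonglongrightarrow> ennreal (c * (0 / (1 - r)))"
    using r by (intro tendsto_ennrealI tendsto_intros LIMSEQ_realpow_zero) auto
  have "cover_sum f {x. \<exists>\<^sub>\<infinity>n. x \<in> Y n} \<beta> N \<epsilon> \<le> ennreal (c * (0 / (1 - r)))"
  proof (rule LIMSEQ_le_const[OF lim], intro exI[of _ N] allI impI)
    fix M assume "N \<le> M"
    from cover_sum_mono_length[OF this] bound
    show "cover_sum f {x. \<exists>\<^sub>\<infinity>n. x \<in> Y n} \<beta> N \<epsilon> \<le> ennreal (c * (r ^ M / (1 - r)))"
      by (rule order_trans)
  qed
  then show ?thesis by simp
qed

lemma block_in_words:
  assumes "w \<in> words A (j + (m * k + r))" "l < m"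
  shows "take k (drop (j + l * k) w) \<in> words A k"
proof -
  have "l * k + k \<le> m * k" using mult_le_mono1[of "Suc l" m k] assms(2) by simp
  then show ?thesis using assms(1) by (auto simp: words_def dest: in_set_takeD in_set_dropD)
qed

text \<open>Peeling off the first block gives a factor of at most 1 for each block; the last
  \<open>r\<close> letters are unconstrained and merely counted.\<close>

lemma sum_block_products:
  fixes q :: "'b list \<Rightarrow> real"
  assumes A: "finite A" and q: "\<And>w. w \<in> words A k \<Longrightarrow> 0 \<le> q w" "(\<Sum>w\<in>words A k. q w) \<le> 1"
  shows "(\<Sum>v\<in>words A (m * k + r). \<Prod>l<m. q (take k (drop (l * k) v))) \<le> real (card A) ^ r"
proof (induction m)
  case 0
  then show ?case by (simp add: card_words[OF A])
next
  case (Suc m)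
  let ?P = "\<lambda>v. \<Prod>l<m. q (take k (drop (l * k) v))"
  have "Suc m * k + r = k + (m * k + r)" by simp
  then have "(\<Sum>v\<in>words A (Suc m * k + r). \<Prod>l<Suc m. q (take k (drop (l * k) v)))
    = (\<Sum>u\<in>words A k. \<Sum>v\<in>words A (m * k + r). \<Prod>l<Suc m. q (take k (drop (l * k) (u @ v))))"
    by (simp only: sum_words_add)
  also have "\<dots> = (\<Sum>u\<in>words A k. \<Sum>v\<in>words A (m * k + r). q u * ?P v)"
    by (intro sum.cong refl, subst prod.lessThan_Suc_shift) (auto simp: words_def)
  also have "\<dots> = (\<Sum>u\<in>words A k. q u) * (\<Sum>v\<in>words A (m * k + r). ?P v)"
    by (simp add: sum_product)
  also have "\<dots> \<le> 1 * real (card A) ^ r"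
    using q block_in_words[of _ A 0 m k r]
    by (intro mult_mono Suc sum_nonneg prod_nonneg) auto
  finally show ?case by simp
qed

text \<open>Markov's inequality for counting: a word of cost below \<open>B\<close> has a block
  product of at least \<open>exp (- B)\<close>, while these products sum to at most the number of
  choices for the \<open>j + r\<close> letters outside the blocks.\<close>

lemma card_low_cost_words:
  fixes q :: "'b list \<Rightarrow> real"
  assumes A: "finite A" and q: "\<And>w. w \<in> words A k \<Longrightarrow> 0 < q w" "(\<Sum>w\<in>words A k. q w) \<le> 1"
  shows "real (card {w \<in> words A (j + (m * k + r)). (\<Sum>l<m. - ln (q (take k (drop (j + l * k) w)))) < B})
    \<le> exp B * real (card A) ^ (j + r)" (is "real (card ?S) \<le> _")
proof -
  let ?F = "\<lambda>w. \<Prod>l<m. q (take k (drop (j + l * k) w))"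
  have "real (card ?S) * exp (- B) = (\<Sum>w\<in>?S. exp (- B))" by simp
  also have "\<dots> \<le> (\<Sum>w\<in>?S. ?F w)"
  proof (rule sum_mono)
    fix w assume w: "w \<in> ?S"
    then have pos: "0 < q (take k (drop (j + l * k) w))" if "l < m" for l
      using block_in_words[of w A j m k r l] that by (intro q(1)) auto
    have "?F w = exp (ln (?F w))" using pos by (intro exp_ln[symmetric] prod_pos) auto
    also have "ln (?F w) = (\<Sum>l<m. ln (q (take k (drop (j + l * k) w))))"
      
    proof (rule ln_prod)
      show "q (take k (drop (j + l * k) w)) \<noteq> 0" if "l \<in> {..<m}" for l
        using pos[of l] that by auto
    qed simp
    finally show "exp (- B) \<le> ?F w" using w by (simp add: sum_negf)
  qed
  also have "\<dots> \<le> (\<Sum>w\<in>words A (j + (m * k + r)). ?F w)"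
  proof (rule sum_mono2)
    fix w assume "w \<in> words A (j + (m * k + r)) - ?S"
    then show "0 \<le> ?F w" by (intro prod_nonneg less_imp_le q(1) block_in_words) auto
  qed (auto simp: finite_words[OF A])
  also have "\<dots> = (\<Sum>u\<in>words A j. \<Sum>v\<in>words A (m * k + r). \<Prod>l<m. q (take k (drop (l * k) v)))"
    unfolding sum_words_add by (intro sum.cong refl) (auto simp: words_def)
  also have "\<dots> \<le> (\<Sum>u\<in>words A j. real (card A) ^ r)"
    using q by (intro sum_mono sum_block_products[OF A]) (auto intro: less_imp_le)
  also have "\<dots> = real (card A) ^ (j + r)" by (simp add: card_words[OF A] power_add)
  finally show ?thesis by (simp add: exp_minus field_simps)
qed

lemma take_drop_itinerary:
  assumes "a + k \<le> L" shows "take k (drop a (itinerary f \<xi> L x)) = itinerary f \<xi> k ((f ^^ a) x)"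
proof -
  have "L = a + (k + (L - a - k))" using assms by simp
  then have "itinerary f \<xi> L x
    = itinerary f \<xi> a x @ itinerary f \<xi> k ((f ^^ a) x) @ itinerary f \<xi> (L - a - k) ((f ^^ k) ((f ^^ a) x))"
    by (metis itinerary_add)
  then show ?thesis by simp
qed

text \<open>The Birkhoff sum of \<open>- ln q / k\<close> averages over the \<open>k\<close> ways of
  cutting the orbit into consecutive blocks of length \<open>k\<close>. Some phase costs no more
  than the average, and the cheap words of a fixed phase can be counted. The small mesh turns equal
  words into Bowen balls.\<close>

lemma (in coding) low_cost_points_covered:
  fixes q :: "'b list \<Rightarrow> real"
  assumes small: "\<And>x y. \<xi> x = \<xi> y \<Longrightarrow> dist x y < \<epsilon>" and k: "0 < k"
    and q: "\<And>w. w \<in> words A k \<Longrightarrow> 0 < q w" "(\<Sum>w\<in>words A k. q w) \<le> 1"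
  obtains F where "finite F" "real (card F) \<le> (real k * real (card A) ^ (2 * k) * exp C) * exp (\<alpha> * real n)"
    "{x. (\<Sum>i<n. - ln (q (itinerary f \<xi> k ((f ^^ i) x))) / real k) < \<alpha> * real n + C}
      \<subseteq> (\<Union>x\<in>F. bowen_ball f n x \<epsilon>)"
proof -
  define m where "m = n div k"
  \<comment> \<open>Enough room for \<open>m\<close> blocks starting at any phase
    \<open>j < k\<close> and for the first \<open>n\<close> letters. At each phase
    \<open>2 * k\<close> letters stay outside the blocks, whence the factor
    \<open>card A ^ (2 * k)\<close>.\<close>
  define L where "L = m * k + 2 * k"
  have "n = m * k + n mod k" "n mod k < k" using k by (simp_all add: m_def)
  then have nL: "n \<le> L" "m * k \<le> n" by (simp_all add: L_def)
  define B where "B = \<alpha> * real n + C"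
  define S where "S j = {w \<in> words A (j + (m * k + (2 * k - j))).
    (\<Sum>l<m. - ln (q (take k (drop (j + l * k) w)))) < B}" for j
  \<comment> \<open>One centre per word. For a word that no orbit realises the choice is arbitrary;
    such centres affect the count only, which is a count of words anyway.\<close>
  define rep where "rep w = (SOME x. itinerary f \<xi> L x = w)" for w
  define F where "F = rep ` (\<Union>j<k. S j)"
  have finS: "finite (S j)" for j unfolding S_def by (simp add: finite_words[OF finite_A])
  have q1: "q w \<le> 1" if "w \<in> words A k" for w
    using member_le_sum[of w "words A k" q] that q finite_words[OF finite_A] by (fastforce intro: less_imp_le order_trans)
  define \<phi> where "\<phi> x = - ln (q (itinerary f \<xi> k x)) / real k" for x
  have \<phi>: "0 \<le> \<phi> x" for x
    using q(1)[OF itinerary_in] q1[OF itinerary_in] by (simp add: \<phi>_def divide_nonpos_nonneg)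
  show thesis
  proof (rule that)
    show "finite F" unfolding F_def using finS by auto
    have "real (card F) \<le> real (card (\<Union>j<k. S j))"
      unfolding F_def by (intro of_nat_mono card_image_le) (use finS in auto)
    also have "\<dots> \<le> real (\<Sum>j<k. card (S j))"
      by (intro of_nat_mono card_UN_le) auto
    also have "\<dots> = (\<Sum>j<k. real (card (S j)))" by simp
    also have "\<dots> \<le> (\<Sum>j<k. exp B * real (card A) ^ (2 * k))"
    proof (rule sum_mono)
      fix j assume "j \<in> {..<k}"
      then have "j + (2 * k - j) = 2 * k" by simp
      then show "real (card (S j)) \<le> exp B * real (card A) ^ (2 * k)"
        using card_low_cost_words[OF finite_A q, of j m "2 * k - j" B] by (simp only: S_def)
    qed
    also have "\<dots> = (real k * real (card A) ^ (2 * k) * exp C) * exp (\<alpha> * real n)"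
      by (simp add: B_def exp_add)
    finally show "real (card F) \<le> (real k * real (card A) ^ (2 * k) * exp C) * exp (\<alpha> * real n)" .
    show "{x. (\<Sum>i<n. - ln (q (itinerary f \<xi> k ((f ^^ i) x))) / real k) < \<alpha> * real n + C}
      \<subseteq> (\<Union>x\<in>F. bowen_ball f n x \<epsilon>)"
    proof
      fix x assume "x \<in> {x. (\<Sum>i<n. - ln (q (itinerary f \<xi> k ((f ^^ i) x))) / real k) < \<alpha> * real n + C}"
      then have less: "(\<Sum>i<n. \<phi> ((f ^^ i) x)) < B" by (simp add: \<phi>_def B_def)
      have "(\<Sum>j<k. \<Sum>l<m. \<phi> ((f ^^ (j + l * k)) x)) = (\<Sum>l<m. \<Sum>j<k. \<phi> ((f ^^ (j + l * k)) x))"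
        by (rule sum.swap)
      also have "\<dots> = (\<Sum>l<m. \<Sum>i\<in>{l * k..<l * k + k}. \<phi> ((f ^^ i) x))"
      proof (rule sum.cong[OF refl])
        fix l
        show "(\<Sum>j<k. \<phi> ((f ^^ (j + l * k)) x)) = (\<Sum>i\<in>{l * k..<l * k + k}. \<phi> ((f ^^ i) x))"
          using sum.shift_bounds_nat_ivl[of "\<lambda>i. \<phi> ((f ^^ i) x)" 0 "l * k" k]
          by (simp only: add_0 atLeast0LessThan add.commute)
      qed
      also have "\<dots> = (\<Sum>i<m * k. \<phi> ((f ^^ i) x))" by (rule sum.nat_group)
      also have "\<dots> \<le> (\<Sum>i<n. \<phi> ((f ^^ i) x))"
        by (rule sum_mono2) (use nL \<phi> in auto)
      finally have sum_less: "(\<Sum>j<k. \<Sum>l<m. \<phi> ((f ^^ (j + l * k)) x)) < B" using less by simp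
      \<comment> \<open>Pigeonhole over the phases: if each phase contributed at least
        \<open>B / k\<close>, the total would reach \<open>B\<close>.\<close>
      have "\<exists>j<k. real k * (\<Sum>l<m. \<phi> ((f ^^ (j + l * k)) x)) < B"
      proof (rule ccontr)
        assume "\<not> ?thesis"
        then have "B \<le> real k * (\<Sum>l<m. \<phi> ((f ^^ (j + l * k)) x))" if "j < k" for j
          using that by (meson not_less)
        then have "B / real k \<le> (\<Sum>l<m. \<phi> ((f ^^ (j + l * k)) x))" if "j < k" for j
          using that k by (simp add: pos_divide_le_eq mult.commute)
        then have "(\<Sum>j<k. B / real k) \<le> (\<Sum>j<k. \<Sum>l<m. \<phi> ((f ^^ (j + l * k)) x))"
          by (intro sum_mono) auto
        then show False using sum_less k by simp
      qed
      then obtain j where j: "j < k" "real k * (\<Sum>l<m. \<phi> ((f ^^ (j + l * k)) x)) < B" by auto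
      let ?w = "itinerary f \<xi> L x"
      have "take k (drop (j + l * k) ?w) = itinerary f \<xi> k ((f ^^ (j + l * k)) x)" if "l < m" for l
      proof (rule take_drop_itinerary)
        have "l * k + k \<le> m * k" using mult_le_mono1[of "Suc l" m k] that by simp
        then show "j + l * k + k \<le> L" using j by (simp add: L_def)
      qed
      then have "(\<Sum>l<m. - ln (q (take k (drop (j + l * k) ?w)))) = real k * (\<Sum>l<m. \<phi> ((f ^^ (j + l * k)) x))"
        unfolding sum_distrib_left using k by (intro sum.cong) (auto simp: \<phi>_def)
      moreover have "j + (m * k + (2 * k - j)) = L" using j by (simp add: L_def)
      ultimately have "?w \<in> S j" using j itinerary_in[of L x] by (simp add: S_def)
      then have F: "rep ?w \<in> F" unfolding F_def using j(1) by blast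
      have "itinerary f \<xi> L (rep ?w) = ?w" unfolding rep_def by (rule someI[of _ x]) simp
      then have "\<xi> ((f ^^ i) (rep ?w)) = \<xi> ((f ^^ i) x)" if "i < n" for i
        using itinerary_nth[of i L f \<xi>] that nL by (metis less_le_trans)
      then have "x \<in> bowen_ball f n (rep ?w) \<epsilon>" by (auto simp: bowen_ball_def intro: small)
      then show "x \<in> (\<Union>x\<in>F. bowen_ball f n x \<epsilon>)" using F by blast
    qed
  qed
qed

text \<open>Allowing an arbitrary additive constant makes the set strictly invariant, so ergodicity
  leaves only the measures 0 and 1. Measure 0 is refuted by integrating a single Birkhoff sum of
  length \<open>m\<close> over the points where the linear lower bound already holds from time
  \<open>m\<close> on, and letting \<open>m\<close> grow.\<close>

lemma ergodic_recurrence: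
  fixes \<phi> :: "'a::metric_space \<Rightarrow> real"
  assumes erg: "\<nu> \<in> ergodic_measures f" and meas [measurable]: "\<phi> \<in> borel_measurable borel"
    and nonneg: "\<And>x. 0 \<le> \<phi> x" and bound: "\<And>x. \<phi> x \<le> b" and less: "(LINT x|\<nu>. \<phi> x) < \<alpha>"
  shows "measure \<nu> (\<Union>C::nat. {x. \<exists>\<^sub>\<infinity>n. (\<Sum>i<n. \<phi> ((f ^^ i) x)) < \<alpha> * real n + real C}) = 1"
proof -
  have inv: "\<nu> \<in> invariant_measures f" using erg by (simp add: ergodic_measures_def)
  note nu = invariant_measuresD[OF inv]
  interpret prob_space \<nu> by (rule nu(1))
  have [measurable_cong, simp]: "sets \<nu> = sets borel" and sp [simp]: "space \<nu> = UNIV" by (fact nu)+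
  define S where "S n x = (\<Sum>i<n. \<phi> ((f ^^ i) x))" for n x
  have fn [measurable]: "(f ^^ n) \<in> borel_measurable borel" for n
    by (rule measurable_funpow[OF nu(6)])
  have S_meas [measurable]: "S n \<in> borel_measurable borel" for n
    unfolding S_def by measurable
  define D where "D = {x. \<exists>C::nat. \<forall>m. \<exists>n\<ge>m. S n x < \<alpha> * real n + real C}"
  have D_eq: "(\<Union>C::nat. {x. \<exists>\<^sub>\<infinity>n. (\<Sum>i<n. \<phi> ((f ^^ i) x)) < \<alpha> * real n + real C}) = D"
    by (auto simp: D_def S_def INFM_nat_le)
  have D_sets: "D \<in> sets borel" unfolding D_def by measurable
  have S_shift: "S n (f x) = S (Suc n) x - \<phi> x" for n x
    unfolding S_def by (subst sum.lessThan_Suc_shift) (simp add: funpow_swap1)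
  have "f -` D = D"
  proof (intro equalityI subsetI)
    fix x assume "x \<in> f -` D"
    then obtain C :: nat where C: "\<And>m. \<exists>n\<ge>m. S n (f x) < \<alpha> * real n + real C" by (auto simp: D_def)
    \<comment> \<open>Going back from \<open>f x\<close> to \<open>x\<close> adds the term \<phi> x
      \<le> b and lengthens the sum by one, which changes \<alpha> n by at most |\<alpha>|.\<close>
    define C' where "C' = C + nat \<lceil>b + \<bar>\<alpha>\<bar>\<rceil>"
    have C': "real C + b + \<bar>\<alpha>\<bar> \<le> real C'" unfolding C'_def by linarith
    have "\<exists>n\<ge>m. S n x < \<alpha> * real n + real C'" for m
    proof -
      obtain n where n: "m \<le> n" "S n (f x) < \<alpha> * real n + real C" using C[of m] by auto
      have "S (Suc n) x < \<alpha> * real (Suc n) + real C'"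
        using n S_shift[of n x] bound[of x] C' by (simp add: algebra_simps)
      then show ?thesis using n by (intro exI[of _ "Suc n"]) simp
    qed
    then show "x \<in> D" by (auto simp: D_def)
  next
    fix x assume "x \<in> D"
    then obtain C :: nat where C: "\<And>m. \<exists>n\<ge>m. S n x < \<alpha> * real n + real C" by (auto simp: D_def)
    define C' where "C' = C + nat \<lceil>\<bar>\<alpha>\<bar>\<rceil>"
    have C': "real C + \<bar>\<alpha>\<bar> \<le> real C'" unfolding C'_def by linarith
    have "\<exists>n\<ge>m. S n (f x) < \<alpha> * real n + real C'" for m
    proof -
      obtain n where n: "Suc m \<le> n" "S n x < \<alpha> * real n + real C" using C[of "Suc m"] by auto
      then obtain n' where n': "n = Suc n'" by (cases n) auto
      have "S n' (f x) < \<alpha> * real n' + real C'"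
        using n S_shift[of n' x] nonneg[of x] C' by (simp add: n' algebra_simps)
      then show ?thesis using n n' by (intro exI[of _ n']) simp
    qed
    then show "x \<in> f -` D" by (auto simp: D_def)
  qed
  then have "prob D = 0 \<or> prob D = 1"
    using erg D_sets by (auto simp: ergodic_measures_def)
  moreover have "prob D \<noteq> 0"
  proof
    assume D0: "prob D = 0"
    \<comment> \<open>Outside \<open>D\<close> already the constant 0 fails, so these sets exhaust
      the complement of \<open>D\<close>. Only the case \<open>n = m\<close> of the bound is
      integrated; off \<open>E m\<close> the estimate \<open>0 \<le> S m\<close> takes over.\<close>
    define E where "E m = {x. \<forall>n\<ge>m. \<alpha> * real n \<le> S n x}" for m
    have E_sets: "E m \<in> sets borel" for m unfolding E_def by measurable
    have "- D \<subseteq> (\<Union>m. E m)"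
    proof
      fix x assume "x \<in> - D"
      then have "\<not> (\<forall>m. \<exists>n\<ge>m. S n x < \<alpha> * real n + real (0::nat))" unfolding D_def by blast
      then show "x \<in> (\<Union>m. E m)" by (auto simp: E_def not_less)
    qed
    then have "prob (- D) \<le> prob (\<Union>m. E m)"
      by (rule finite_measure_mono) (use E_sets in auto)
    moreover have "prob (- D) = 1" using prob_compl[of D] D0 D_sets by (simp add: Compl_eq_Diff_UNIV)
    ultimately have 1: "prob (\<Union>m. E m) = 1" using prob_le_1[of "\<Union>m. E m"] by linarith
    have "(\<lambda>m. prob (E m)) \<longlonglongrightarrow> prob (\<Union>m. E m)"
      by (rule finite_Lim_measure_incseq) (use E_sets in \<open>auto simp: incseq_def E_def\<close>)
    then have lim: "(\<lambda>m. \<alpha> * prob (E m)) \<longlonglongrightarrow> \<alpha> * 1"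
      unfolding 1 by (rule tendsto_mult_left)
    have int: "integrable \<nu> (\<lambda>x. \<phi> ((f ^^ i) x))" for i
      by (rule integrable_const_bound[of _ b]) (use nonneg bound in auto)
    have "\<alpha> * prob (E m) \<le> (LINT x|\<nu>. \<phi> x)" if m: "1 \<le> m" for m
    proof -
      have "(\<alpha> * real m) * prob (E m) = (LINT x|\<nu>. (\<alpha> * real m) * indicator (E m) x)"
        using E_sets by simp
      also have "\<dots> \<le> (LINT x|\<nu>. S m x)"
      proof (rule integral_mono)
        show "integrable \<nu> (\<lambda>x. (\<alpha> * real m) * indicator (E m) x)"
          using E_sets by (intro integrable_mult_right integrable_real_indicator) (auto simp: less_top[symmetric])
        show "integrable \<nu> (S m)" unfolding S_def by (intro Bochner_Integration.integrable_sum int)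
        fix x
        have "0 \<le> S m x" unfolding S_def by (intro sum_nonneg nonneg)
        then show "(\<alpha> * real m) * indicator (E m) x \<le> S m x" by (auto simp: E_def indicator_def)
      qed
      also have "\<dots> = (\<Sum>i<m. (LINT x|\<nu>. \<phi> ((f ^^ i) x)))"
        unfolding S_def by (intro Bochner_Integration.integral_sum int)
      also have "\<dots> = real m * (LINT x|\<nu>. \<phi> x)"
        by (simp add: integral_funpow[OF inv meas])
      finally have "real m * (\<alpha> * prob (E m)) \<le> real m * (LINT x|\<nu>. \<phi> x)" by (simp add: algebra_simps)
      then show ?thesis using m by simp
    qed
    then have "\<alpha> * 1 \<le> (LINT x|\<nu>. \<phi> x)"
      by (intro LIMSEQ_le_const2[OF lim]) auto
    then show False using less by simp
  qed
  ultimately show ?thesis by (simp add: D_eq)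
qed

text \<open>\<open>PiE\<close> pins the values off \<open>words A k\<close>, so finitely many
  rational coordinates determine a weight. Strict positivity keeps the cost of every word meaningful
  and bounded, also for words that are null for the measure at hand.\<close>

definition rational_weights :: "'b set \<Rightarrow> nat \<Rightarrow> ('b list \<Rightarrow> real) set" where
  "rational_weights A k =
    {q \<in> PiE (words A k) (\<lambda>_. \<rat>). (\<forall>w\<in>words A k. 0 < q w) \<and> (\<Sum>w\<in>words A k. q w) \<le> 1}"

lemma countable_rational_weights: "finite A \<Longrightarrow> countable (rational_weights A k)"
  unfolding rational_weights_def
  by (rule countable_subset[of _ "PiE (words A k) (\<lambda>_. \<rat>)"])
    (auto intro: countable_PiE finite_words countable_rat)

lemma (in coding_measure) rational_weights_cross_entropy:
  assumes "0 < \<eta>"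
  obtains q where "q \<in> rational_weights A k"
    "(LINT x|\<mu>. - ln (q (itinerary f \<xi> k x))) \<le> block_entropy k + \<eta>"
proof -
  let ?W = "words A k"
  \<comment> \<open>With \<open>p = word_prob w\<close>, the rational value is taken above
    \<open>s * (s * p)\<close>, so that its cost exceeds \<open>- ln p\<close> by at most \<eta>,
    and below \<open>s * p + (1 - s) / card W\<close>, so that the total is at most 1. The second
    summand leaves room even where \<open>p\<close> vanishes.\<close>
  define s where "s = exp (- \<eta> / 2)"
  have s: "0 < s" "s < 1" using assms by (auto simp: s_def)
  have cW: "0 < real (card ?W)" using card_A by (simp add: card_words[OF finite_A])
  have "\<exists>r\<in>\<rat>. s * (s * word_prob w) < r \<and> r < s * word_prob w + (1 - s) / real (card ?W)" for w
  proof (rule Rats_dense_in_real)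
    have "s * (s * word_prob w) \<le> 1 * (s * word_prob w)"
      using s by (intro mult_right_mono) auto
    also have "\<dots> < s * word_prob w + (1 - s) / real (card ?W)" using s cW by simp
    finally show "s * (s * word_prob w) < s * word_prob w + (1 - s) / real (card ?W)" .
  qed
  then obtain r where r: "\<And>w. r w \<in> \<rat>" "\<And>w. s * (s * word_prob w) < r w"
    "\<And>w. r w < s * word_prob w + (1 - s) / real (card ?W)" by metis
  define q where "q = restrict r ?W"
  have q: "q w = r w" if "w \<in> ?W" for w using that by (simp add: q_def)
  have pos: "0 < r w" for w
    using r(2)[of w] s by (meson le_less_trans less_imp_le mult_nonneg_nonneg word_prob_nonneg)
  show thesis
  proof (rule that)
    have "(\<Sum>w\<in>?W. q w) \<le> (\<Sum>w\<in>?W. s * word_prob w + (1 - s) / real (card ?W))"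
      by (intro sum_mono) (use q r(3) in \<open>auto intro: less_imp_le\<close>)
    also have "\<dots> = s * 1 + (1 - s)"
      using cW by (simp add: sum.distrib sum_word_prob flip: sum_distrib_left)
    finally show "q \<in> rational_weights A k"
      using r(1) pos by (auto simp: rational_weights_def q) (auto simp: q_def)
    have "(LINT x|\<mu>. - ln (q (itinerary f \<xi> k x))) = (\<Sum>w\<in>?W. word_prob w * - ln (q w))"
      by (rule integral_itinerary)
    also have "\<dots> \<le> (\<Sum>w\<in>?W. - (word_prob w * ln (word_prob w)) + \<eta> * word_prob w)"
    proof (rule sum_mono)
      fix w assume w: "w \<in> ?W"
      show "word_prob w * - ln (q w) \<le> - (word_prob w * ln (word_prob w)) + \<eta> * word_prob w"
      proof (cases "word_prob w = 0")
        case False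
        then have p: "0 < word_prob w" using word_prob_nonneg[of w] by linarith
        have "ln (s * (s * word_prob w)) \<le> ln (r w)"
          using r(2)[of w] s p by (intro ln_mono less_imp_le) auto
        then have "- \<eta> + ln (word_prob w) \<le> ln (r w)"
          using s p by (simp add: ln_mult) (simp add: s_def)
        then have "word_prob w * - ln (r w) \<le> word_prob w * (\<eta> - ln (word_prob w))"
          using p by (intro mult_left_mono) auto
        then show ?thesis using q[OF w] by (simp add: algebra_simps)
      qed simp
    qed
    also have "\<dots> = block_entropy k + \<eta>"
      by (simp only: sum.distrib block_entropy_def sum_word_prob mult_1_right sum_distrib_left[symmetric])
    finally show "(LINT x|\<mu>. - ln (q (itinerary f \<xi> k x))) \<le> block_entropy k + \<eta>" .
  qed
qed

text \<open>Each piece \<open>Y k q C\<close> has vanishing cover sums for \<beta> > \<alpha> by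
  counting, and this survives countable unions. A given \<nu> needs a single \<open>k\<close> with
  block entropy below \<alpha> k and a single rational weight, whose approximation error is half of
  the remaining gap.\<close>

lemma (in coding) universal_low_entropy_set:
  assumes small: "\<And>x y. \<xi> x = \<xi> y \<Longrightarrow> dist x y < \<epsilon>"
  obtains Z where "Z \<in> sets borel" "\<And>\<beta> N. \<alpha> < \<beta> \<Longrightarrow> cover_sum f Z \<beta> N \<epsilon> = 0"
    "\<And>\<nu>. \<nu> \<in> ergodic_measures f \<Longrightarrow> coding_measure.entropy_rate f \<xi> A \<nu> < \<alpha> \<Longrightarrow> measure \<nu> Z = 1"
proof -
  define \<phi> where "\<phi> k q x = - ln (q (itinerary f \<xi> k x)) / real k" for k :: nat and q :: "'b list \<Rightarrow> real" and x
  define Y where "Y k q C = {x. \<exists>\<^sub>\<infinity>n. (\<Sum>i<n. \<phi> k q ((f ^^ i) x)) < \<alpha> * real n + real C}" for k q and C :: nat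
  define T where "T = Sigma {0::nat<..} (rational_weights A)"
  define Z where "Z = (\<Union>(k, q)\<in>T. \<Union>C. Y k q C)"
  have T: "countable T"
    unfolding T_def by (intro countable_SIGMA countable_rational_weights finite_A) auto
  have \<phi>_meas [measurable]: "\<phi> k q \<in> borel_measurable borel" for k q
    unfolding \<phi>_def by (rule itinerary_fun_borel)
  have [measurable]: "(f ^^ n) \<in> borel_measurable borel" for n by (rule funpow_borel)
  have Y: "Y k q C \<in> sets borel" for k q C
    unfolding Y_def INFM_nat_le by measurable
  show thesis
  proof (rule that)
    show "Z \<in> sets borel"
      unfolding Z_def by (intro sets.countable_UN'[OF T]) (auto intro: Y)
    show "cover_sum f Z \<beta> N \<epsilon> = 0" if "\<alpha> < \<beta>" for \<beta> N
      unfolding Z_def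
    proof (rule cover_sum_countable_UN_eq_0[OF T], clarify, rule cover_sum_UN_eq_0)
      fix k q C assume "(k, q) \<in> T"
      then have k: "0 < k" and q: "\<And>w. w \<in> words A k \<Longrightarrow> 0 < q w" "(\<Sum>w\<in>words A k. q w) \<le> 1"
        by (auto simp: T_def rational_weights_def)
      let ?Y = "\<lambda>n. {x. (\<Sum>i<n. \<phi> k q ((f ^^ i) x)) < \<alpha> * real n + real C}"
      have "\<exists>F. finite F \<and> real (card F) \<le> (real k * real (card A) ^ (2 * k) * exp (real C)) * exp (\<alpha> * real n)
        \<and> ?Y n \<subseteq> (\<Union>x\<in>F. bowen_ball f n x \<epsilon>)" for n
        unfolding \<phi>_def
        by (rule low_cost_points_covered[OF small k q, of "real C" \<alpha> n]) auto
      then obtain F where F: "\<And>n. finite (F n)"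
        "\<And>n. real (card (F n)) \<le> (real k * real (card A) ^ (2 * k) * exp (real C)) * exp (\<alpha> * real n)"
        "\<And>n. ?Y n \<subseteq> (\<Union>x\<in>F n. bowen_ball f n x \<epsilon>)"
        by metis
      have "cover_sum f {x. \<exists>\<^sub>\<infinity>n. x \<in> ?Y n} \<beta> N \<epsilon> = 0"
        by (rule cover_sum_infinitely_often_eq_0[OF F that])
      then show "cover_sum f (Y k q C) \<beta> N \<epsilon> = 0" by (simp add: Y_def)
    qed
    fix \<nu> assume erg: "\<nu> \<in> ergodic_measures f" and less: "coding_measure.entropy_rate f \<xi> A \<nu> < \<alpha>"
    interpret coding_measure f \<xi> A \<nu>
      by unfold_locales (use erg in \<open>simp add: ergodic_measures_def\<close>)
    have "\<forall>\<^sub>F n in sequentially. block_entropy n / real n < \<alpha>"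
      using order_tendstoD(2)[OF entropy_rate_LIMSEQ less] .
    then have "\<forall>\<^sub>F n in sequentially. block_entropy n / real n < \<alpha> \<and> 0 < n"
      using eventually_gt_at_top[of 0] by eventually_elim simp
    then obtain k where k: "block_entropy k / real k < \<alpha>" "0 < k"
      using eventually_happens'[OF sequentially_bot] by blast
    then have "block_entropy k < \<alpha> * real k" by (simp add: divide_less_eq)
    then obtain q where q: "q \<in> rational_weights A k"
      "(LINT x|\<nu>. - ln (q (itinerary f \<xi> k x))) \<le> block_entropy k + (\<alpha> * real k - block_entropy k) / 2"
      using rational_weights_cross_entropy[of "(\<alpha> * real k - block_entropy k) / 2" k] by auto
    have qpos: "0 < q w" and qle: "q w \<le> 1" if "w \<in> words A k" for w
    proof -
      show "0 < q w" using q(1) that by (auto simp: rational_weights_def)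
      have "q w \<le> (\<Sum>w\<in>words A k. q w)"
        using q(1) that by (intro member_le_sum) (auto simp: rational_weights_def finite_words finite_A intro: less_imp_le)
      then show "q w \<le> 1" using q(1) by (auto simp: rational_weights_def)
    qed
    have "measure \<nu> (\<Union>C. Y k q C) = 1"
      unfolding Y_def
    proof (rule ergodic_recurrence[OF erg \<phi>_meas])
      show "0 \<le> \<phi> k q x" for x
        using qpos[OF itinerary_in, of x] qle[OF itinerary_in, of x] by (simp add: \<phi>_def divide_nonpos_nonneg)
      show "\<phi> k q x \<le> (\<Sum>w\<in>words A k. - ln (q w)) / real k" for x
        unfolding \<phi>_def
        by (intro divide_right_mono member_le_sum itinerary_in finite_words finite_A)
          (auto simp: qpos qle)
      have "(LINT x|\<nu>. \<phi> k q x) = (LINT x|\<nu>. - ln (q (itinerary f \<xi> k x))) / real k"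
        unfolding \<phi>_def by (rule integral_divide_zero)
      also have "(LINT x|\<nu>. - ln (q (itinerary f \<xi> k x))) < \<alpha> * real k"
        using q(2) \<open>block_entropy k < \<alpha> * real k\<close> by (simp add: field_simps)
      then have "(LINT x|\<nu>. - ln (q (itinerary f \<xi> k x))) / real k < \<alpha>"
        using k(2) by (simp only: pos_divide_less_eq of_nat_0_less_iff)
      finally show "(LINT x|\<nu>. \<phi> k q x) < \<alpha>" .
    qed
    moreover have "(\<Union>C. Y k q C) \<subseteq> Z" using q(1) k(2) by (force simp: Z_def T_def)
    then have "measure \<nu> (\<Union>C. Y k q C) \<le> measure \<nu> Z"
      by (rule finite_measure_mono) (simp add: \<open>Z \<in> sets borel\<close>)
    ultimately show "measure \<nu> Z = 1" using prob_le_1[of Z] by simp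
  qed
qed

section \<open>The lower bound by block codes\<close>

text \<open>Inner and outer approximation are proved together, so that complements merely exchange
  them. For a closed set the open neighbourhoods of radius 1 / (n + 1) shrink to it; for a union the
  errors are spread geometrically.\<close>

lemma closed_open_approximation:
  fixes M :: "'a::metric_space measure"
  assumes "finite_measure M" and M: "sets M = sets borel" and B: "B \<in> sets borel" and "0 < e"
  shows "\<exists>C U. closed C \<and> open U \<and> C \<subseteq> B \<and> B \<subseteq> U \<and> measure M (U - C) < e"
proof -
  interpret finite_measure M by fact
  have cl: "C \<in> sets M" if "closed C" for C using that by (simp add: M)
  have op: "U \<in> sets M" if "open U" for U using that by (simp add: M)
  have "B \<in> sigma_sets UNIV (Collect closed)"
    using B by (simp add: borel_eq_closed)
  then show ?thesis using \<open>0 < e\<close>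
  proof (induction arbitrary: e)
    case (Basic B)
    then have B: "closed B" by simp
    show ?case
    proof (cases "B = {}")
      case True
      with Basic show ?thesis by (intro exI[of _ "{}"]) auto
    next
      case False
      define U where "U n = {x. infdist x B < 1 / real (Suc n)}" for n
      have U: "open (U n)" for n unfolding U_def by (intro open_Collect_less continuous_intros)
      have "decseq U"
        unfolding decseq_Suc_iff U_def by (auto elim!: less_le_trans simp: frac_le)
      have "(\<Inter>n. U n) = B"
      proof (intro equalityI subsetI)
        fix x assume x: "x \<in> (\<Inter>n. U n)"
        have "infdist x B \<le> 0"
        proof (rule ccontr)
          assume "\<not> infdist x B \<le> 0"
          then obtain n where "inverse (real (Suc n)) < infdist x B" using reals_Archimedean[of "infdist x B"] by auto
          moreover have "infdist x B < 1 / real (Suc n)" using x by (auto simp: U_def)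
          ultimately show False by (simp add: inverse_eq_divide)
        qed
        then have "infdist x B = 0" using infdist_nonneg[of x B] by linarith
        then show "x \<in> B" using in_closed_iff_infdist_zero[OF B False] by simp
      qed (auto simp: U_def)
      then have "(\<lambda>n. measure M (U n)) \<longlonglongrightarrow> measure M B"
        using finite_Lim_measure_decseq[of U, OF _ \<open>decseq U\<close>] U op by auto
      from order_tendstoD(2)[OF this, of "measure M B + e"] Basic
      obtain n where n: "measure M (U n) < measure M B + e"
        by (auto simp: eventually_sequentially)
      have sub: "B \<subseteq> U n" by (auto simp: U_def)
      have "measure M (U n - B) = measure M (U n) - measure M B"
        by (rule finite_measure_Diff[OF op[OF U] cl[OF B] sub])
      then show ?thesis using n B U sub by (intro exI[of _ B] exI[of _ "U n"]) auto
    qed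
  next
    case Empty
    then show ?case by (intro exI[of _ "{}"]) auto
  next
    case (Compl B)
    from Compl.IH[OF Compl.prems] obtain C U where
      "closed C" "open U" "C \<subseteq> B" "B \<subseteq> U" "measure M (U - C) < e" by auto
    moreover have "- C - - U = U - C" by auto
    ultimately show ?case
      by (intro exI[of _ "- U"] exI[of _ "- C"]) (auto simp: Compl_eq_Diff_UNIV[symmetric])
  next
    case (Union B)
    have "\<exists>C U. closed C \<and> open U \<and> C \<subseteq> B i \<and> B i \<subseteq> U \<and> measure M (U - C) < (e / 4) * (1 / 2) ^ i" for i
      by (rule Union.IH) (use Union.prems in simp)
    then obtain C U where CU: "\<And>i. closed (C i)" "\<And>i. open (U i)" "\<And>i. C i \<subseteq> B i" "\<And>i. B i \<subseteq> U i"
      "\<And>i. measure M (U i - C i) < (e / 4) * (1 / 2) ^ i" by metis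
    have sums: "(\<lambda>i. (e / 4) * (1 / 2) ^ i) sums ((e / 4) * (1 / (1 - 1 / 2)))"
      by (intro sums_mult geometric_sums) simp
    have summ: "summable (\<lambda>i. measure M (U i - C i))"
      by (rule summable_comparison_test'[OF sums_summable[OF sums], of 0]) (use CU in \<open>auto intro: less_imp_le\<close>)
    have "measure M (\<Union>i. U i - C i) \<le> (\<Sum>i. measure M (U i - C i))"
      by (rule finite_measure_subadditive_countably[OF _ summ]) (use CU cl op in auto)
    also have "\<dots> \<le> (\<Sum>i. (e / 4) * (1 / 2) ^ i)"
      by (rule suminf_le[OF _ summ sums_summable[OF sums]]) (use CU in \<open>auto intro: less_imp_le\<close>)
    also have "\<dots> = e / 2" using sums_unique[OF sums] by simp
    finally have 1: "measure M (\<Union>i. U i - C i) \<le> e / 2" .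
    \<comment> \<open>An infinite union of closed sets need not be closed, so only the first
      \<open>n\<close> are kept. The part lost in this way decreases to the empty set.\<close>
    define D where "D n = (\<Union>i. C i) - (\<Union>i<n. C i)" for n
    have Dm: "D n \<in> sets M" for n unfolding D_def using CU cl by auto
    have "(\<lambda>n. measure M (D n)) \<longlonglongrightarrow> measure M (\<Inter>n. D n)"
      by (rule finite_Lim_measure_decseq) (use Dm in \<open>auto simp: decseq_def D_def\<close>)
    moreover have "(\<Inter>n. D n) = {}" by (auto simp: D_def)
    ultimately have "(\<lambda>n. measure M (D n)) \<longlonglongrightarrow> 0" by simp
    from order_tendstoD(2)[OF this, of "e / 2"] Union.prems
    obtain n where n: "measure M (D n) < e / 2" by (auto simp: eventually_sequentially)
    have "measure M ((\<Union>i. U i) - (\<Union>i<n. C i)) \<le> measure M ((\<Union>i. U i - C i) \<union> D n)"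
      by (rule finite_measure_mono) (use CU Dm cl op in \<open>auto simp: D_def\<close>)
    also have "\<dots> \<le> measure M (\<Union>i. U i - C i) + measure M (D n)"
      by (rule measure_Un_le) (use CU Dm cl op in auto)
    finally have "measure M ((\<Union>i. U i) - (\<Union>i<n. C i)) < e" using 1 n by simp
    then show ?case using CU by (intro exI[of _ "\<Union>i<n. C i"] exI[of _ "\<Union>i. U i"]) (auto, blast+)
  qed
qed

text \<open>Every cell contains a closed set that misses little of its mass, and \<open>K\<close> is
  the union of these. The open sets \<open>V a\<close>, which avoid the closed sets of all labels
  but \<open>a\<close>, cover the space; within a Lebesgue number of this cover only one label is
  possible on \<open>K\<close>. The centre of the ball may itself lie outside
  \<open>K\<close>.\<close>

lemma (in coding_measure) code_locally_constant:
  assumes "compact (UNIV :: 'a set)" "0 < \<gamma>"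
  obtains K \<epsilon> u where "K \<in> sets borel" "prob (- K) \<le> \<gamma>" "0 < \<epsilon>"
    "\<And>x y. dist x y < \<epsilon> \<Longrightarrow> y \<in> K \<Longrightarrow> \<xi> y = u x"
proof -
  have "\<exists>C. closed C \<and> C \<subseteq> \<xi> -` {a} \<and> prob (\<xi> -` {a} - C) < \<gamma> / real (card A)" if a: "a \<in> A" for a
  proof -
    obtain C U where CU: "closed C" "open U" "C \<subseteq> \<xi> -` {a}" "\<xi> -` {a} \<subseteq> U" "prob (U - C) < \<gamma> / real (card A)"
      using closed_open_approximation[OF finite_measure_axioms sets_mu code_borel[OF a], of "\<gamma> / real (card A)"] card_A assms by auto
    have "prob (\<xi> -` {a} - C) \<le> prob (U - C)"
      by (rule finite_measure_mono) (use CU in auto)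
    then show ?thesis using CU by (intro exI[of _ C]) auto
  qed
  then obtain C where C: "\<And>a. a \<in> A \<Longrightarrow> closed (C a)" "\<And>a. a \<in> A \<Longrightarrow> C a \<subseteq> \<xi> -` {a}"
    "\<And>a. a \<in> A \<Longrightarrow> prob (\<xi> -` {a} - C a) < \<gamma> / real (card A)" by metis
  define K where "K = (\<Union>a\<in>A. C a)"
  define V where "V a = - (\<Union>b\<in>A - {a}. C b)" for a
  have opn: "open (V a)" for a
    unfolding V_def by (intro open_Compl closed_UN) (use C finite_A in auto)
  have cover: "UNIV \<subseteq> \<Union> (V ` A)"
  proof
    fix x
    have "x \<in> V (\<xi> x)" using C(2) by (auto simp: V_def)
    then show "x \<in> \<Union> (V ` A)" using code_in by blast
  qed
  obtain \<epsilon> where \<epsilon>: "0 < \<epsilon>" "\<And>x. x \<in> UNIV \<Longrightarrow> \<exists>G\<in>V ` A. ball x \<epsilon> \<subseteq> G"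
    by (rule Heine_Borel_lemma[OF assms(1) cover]) (use opn in auto)
  then have "\<forall>x. \<exists>a. ball x \<epsilon> \<subseteq> V a" by blast
  then obtain u where u: "\<And>x. ball x \<epsilon> \<subseteq> V (u x)" by metis
  show thesis
  proof (rule that)
    have clb: "C a \<in> sets borel" if "a \<in> A" for a using C(1)[OF that] by simp
    show "K \<in> sets borel" unfolding K_def using clb finite_A by auto
    have "prob (- K) \<le> prob (\<Union>a\<in>A. \<xi> -` {a} - C a)"
    proof (rule finite_measure_mono)
      show "- K \<subseteq> (\<Union>a\<in>A. \<xi> -` {a} - C a)" using code_in by (auto simp: K_def)
      show "(\<Union>a\<in>A. \<xi> -` {a} - C a) \<in> events"
        using clb code_borel finite_A by auto
    qed
    also have "\<dots> \<le> (\<Sum>a\<in>A. prob (\<xi> -` {a} - C a))"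
      by (rule finite_measure_subadditive_finite) (use clb code_borel finite_A in auto)
    also have "\<dots> \<le> (\<Sum>a\<in>A. \<gamma> / real (card A))"
      by (intro sum_mono less_imp_le C)
    also have "\<dots> = \<gamma>" using card_A by simp
    finally show "prob (- K) \<le> \<gamma>" .
    show "\<xi> y = u x" if "dist x y < \<epsilon>" "y \<in> K" for x y
    proof -
      from that obtain a where a: "a \<in> A" "y \<in> C a" by (auto simp: K_def)
      have "y \<in> V (u x)" using u[of x] that by auto
      then have "a = u x" using a by (auto simp: V_def)
      then show ?thesis using a C(2) by auto
    qed
  qed (fact \<epsilon>(1))
qed

section \<open>Weights on words from a finite family of blocks\<close>

lemma sum_words_prod:
  fixes g :: "nat \<Rightarrow> 'b \<Rightarrow> real"
  shows "(\<Sum>v\<in>words A m. \<Prod>t<m. g t (v ! t)) = (\<Prod>t<m. \<Sum>a\<in>A. g t a)"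
proof (induction m arbitrary: g)
  case (Suc m)
  have "(\<Sum>v\<in>words A (Suc m). \<Prod>t<Suc m. g t (v ! t))
    = (\<Sum>a\<in>A. \<Sum>v\<in>words A m. g 0 a * (\<Prod>t<m. g (Suc t) (v ! t)))"
    unfolding sum_words_Suc by (subst prod.lessThan_Suc_shift) simp
  also have "\<dots> = (\<Sum>a\<in>A. g 0 a) * (\<Sum>v\<in>words A m. \<Prod>t<m. g (Suc t) (v ! t))"
    by (simp add: sum_product)
  also have "\<dots> = (\<Prod>t<Suc m. \<Sum>a\<in>A. g t a)"
    unfolding Suc.IH[of "\<lambda>t. g (Suc t)"] by (subst prod.lessThan_Suc_shift) simp
  finally show ?case .
qed simp

lemma sum_lessThan_add:
  fixes g :: "nat \<Rightarrow> real"
  shows "(\<Sum>t<m + n. g t) = (\<Sum>t<m. g t) + (\<Sum>t<n. g (m + t))"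
  by (induction n) auto

text \<open>Only an inequality, because the reference letter \<open>u\<close> may lie outside
  \<open>A\<close>, and because inside \<open>A\<close> it gives up its share \<theta> / |A| of the
  error mass.\<close>

lemma (in coding) letter_weight_sum:
  assumes "0 \<le> \<theta>" "\<theta> \<le> (1::real)"
  shows "(\<Sum>a\<in>A. if a = u then 1 - \<theta> else \<theta> / real (card A)) \<le> 1"
proof -
  have "(\<Sum>a\<in>A. if a = u then 1 - \<theta> else \<theta> / real (card A))
    \<le> (\<Sum>a\<in>A. (if a = u then 1 - \<theta> else 0) + \<theta> / real (card A))"
    using assms by (intro sum_mono) (auto intro: divide_nonneg_nonneg)
  also have "\<dots> = (\<Sum>a\<in>A. if a = u then 1 - \<theta> else 0) + \<theta>"
    using card_A by (simp add: sum.distrib)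
  also have "(\<Sum>a\<in>A. if a = u then 1 - \<theta> else 0) \<le> 1 - \<theta>"
    using assms finite_A by simp
  finally show ?thesis by simp
qed

text \<open>The weight of a word sums over the ways of parsing it into single letters, each of weight
  \<open>1 / (2 |A|)\<close>, and noisy copies of the reference blocks \<open>u i\<close>, of weight \<open>exp (- \<alpha> n i) / 2\<close> times
  the noise weight. An orbit is parsed greedily: a block whenever one fits, else a letter.\<close>

lemma (in coding) block_weights:
  fixes n :: "'i \<Rightarrow> nat" and u :: "'i \<Rightarrow> nat \<Rightarrow> 'b"
  assumes I: "finite I" "\<And>i. i \<in> I \<Longrightarrow> N\<^sub>0 \<le> n i" "\<And>i. i \<in> I \<Longrightarrow> n i \<le> L" and N0: "0 < N\<^sub>0"
    and weight: "(\<Sum>i\<in>I. exp (- \<alpha> * real (n i))) \<le> 1" and \<alpha>: "0 \<le> \<alpha>"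
    and \<theta>: "0 < \<theta>" "\<theta> < 1"
    and u: "\<And>i x t. i \<in> I \<Longrightarrow> x \<in> B i \<Longrightarrow> t < n i \<Longrightarrow> (f ^^ t) x \<in> K \<Longrightarrow> \<xi> ((f ^^ t) x) = u i t"
  defines "a \<equiv> \<alpha> - ln (1 - \<theta>) + ln 2 / real N\<^sub>0" and "\<kappa> \<equiv> ln (2 * real (card A))"
    and "\<kappa>' \<equiv> ln (real (card A) / \<theta>)"
  shows "\<exists>q. (\<forall>w\<in>words A N. 0 < q w) \<and> (\<Sum>w\<in>words A N. q w) \<le> 1 \<and>
    (\<forall>x. - ln (q (itinerary f \<xi> N x)) \<le> a * real N
      + (\<Sum>t<N. \<kappa>' * indicator (- K) ((f ^^ t) x) + \<kappa> * indicator (- (\<Union>i\<in>I. B i)) ((f ^^ t) x))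
      + \<kappa> * real (min N L))"
proof -
  define c where "c = - ln (1 - \<theta>)"
  define b where "b x = \<kappa>' * indicator (- K) x + \<kappa> * indicator (- (\<Union>i\<in>I. B i)) x" for x
  define Q where "Q N q \<longleftrightarrow> (\<forall>w\<in>words A N. 0 < q w) \<and> (\<Sum>w\<in>words A N. q w) \<le> 1 \<and>
    (\<forall>x. - ln (q (itinerary f \<xi> N x)) \<le> a * real N + (\<Sum>t<N. b ((f ^^ t) x)) + \<kappa> * real (min N L))"
    for N and q :: "'b list \<Rightarrow> real"
  have cA: "1 \<le> real (card A)" using card_A by linarith
  have c: "0 \<le> c" using \<theta> by (simp add: c_def)
  have \<kappa>: "0 \<le> \<kappa>" using cA by (simp add: \<kappa>_def)
  have \<kappa>': "0 \<le> \<kappa>'" unfolding \<kappa>'_def using \<theta> cA by (intro ln_ge_zero) (simp add: le_divide_eq)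
  have a: "0 \<le> a" unfolding a_def using \<alpha> c N0 by (simp add: c_def)
  have b: "\<kappa>' * indicator (- K) x \<le> b x" "\<kappa> * indicator (- (\<Union>i\<in>I. B i)) x \<le> b x" "0 \<le> b x" for x
    using \<kappa> \<kappa>' by (auto simp: b_def indicator_def)
  \<comment> \<open>The reference letter is copied with weight 1 - \<theta>, and every other letter
    is an error of weight \<theta> / |A|. The cost of an error is thus the finite constant
    \<open>\<kappa>'\<close>.\<close>
  define g where "g i t a = (if a = u i t then 1 - \<theta> else \<theta> / real (card A))" for i t a
  define lam where "lam i v = (\<Prod>t<n i. g i t (v ! t))" for i v
  have g: "0 < g i t a" for i t a using \<theta> cA by (simp add: g_def)
  have lam_pos: "0 < lam i v" for i v unfolding lam_def by (intro prod_pos) (use g in auto)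
  have lam_sum: "(\<Sum>v\<in>words A (n i). lam i v) \<le> 1" for i
    unfolding lam_def sum_words_prod
    by (intro prod_le_1 conjI sum_nonneg)
      (use letter_weight_sum \<theta> in \<open>auto simp: g_def\<close>)
  have lam_cost: "- ln (lam i (itinerary f \<xi> (n i) x)) \<le> c * real (n i) + (\<Sum>t<n i. b ((f ^^ t) x))"
    if "i \<in> I" "x \<in> B i" for i x
  proof -
    have "- ln (lam i (itinerary f \<xi> (n i) x)) = (\<Sum>t<n i. - ln (g i t (\<xi> ((f ^^ t) x))))"
      unfolding lam_def by (subst ln_prod) (use g in \<open>auto simp: sum_negf less_imp_neq[symmetric]\<close>)
    also have "\<dots> \<le> (\<Sum>t<n i. c + b ((f ^^ t) x))"
    proof (rule sum_mono)
      fix t assume t: "t \<in> {..<n i}"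
      show "- ln (g i t (\<xi> ((f ^^ t) x))) \<le> c + b ((f ^^ t) x)"
      proof (cases "\<xi> ((f ^^ t) x) = u i t")
        case True
        then show ?thesis using b(3) by (simp add: g_def c_def)
      next
        case False
        \<comment> \<open>Inside \<open>B i\<close> an error can only happen at a visit to the
          complement of \<open>K\<close>, and \<open>b\<close> already charges
          \<open>\<kappa>'\<close> for such a visit.\<close>
        then have "(f ^^ t) x \<notin> K" using u[OF that] t by auto
        then have "\<kappa>' \<le> b ((f ^^ t) x)" using b(1)[of "(f ^^ t) x"] by simp
        moreover have "- ln (g i t (\<xi> ((f ^^ t) x))) = \<kappa>'"
          using False \<theta> cA by (simp add: g_def \<kappa>'_def ln_div)
        ultimately show ?thesis using c by simp
      qed
    qed
    also have "\<dots> = c * real (n i) + (\<Sum>t<n i. b ((f ^^ t) x))" by (simp add: sum.distrib)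
    finally show ?thesis .
  qed
  have "\<exists>q. Q N q"
  proof (induction N rule: less_induct)
    case (less N)
    show ?case
    proof (cases "N = 0")
      case True
      then show ?thesis by (intro exI[of _ "\<lambda>_. 1"]) (simp add: Q_def)
    next
      case False
      from less obtain p where p: "\<And>m. m < N \<Longrightarrow> Q m (p m)" by metis
      define J where "J = {i \<in> I. n i \<le> N}"
      have J: "finite J" "J \<subseteq> I" using I(1) by (auto simp: J_def)
      \<comment> \<open>A word begins with a single letter or with a block that fits. Each of the
        two alternatives receives half of the mass and leaves the rest of the word to the weight
        \<open>p\<close> of the shorter length.\<close>
      define letter where "letter w = 1 / (2 * real (card A)) * p (N - 1) (drop 1 w)" for w :: "'b list"
      define block where "block i w = 1 / 2 * exp (- \<alpha> * real (n i)) * lam i (take (n i) w) * p (N - n i) (drop (n i) w)" for i w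
      define q where "q w = letter w + (\<Sum>i\<in>J. block i w)" for w
      have p_pos: "0 < p m (drop (N - m) w)" if "w \<in> words A N" "m < N" for m w
      proof -
        have "drop (N - m) w \<in> words A m" using that by (auto simp: words_def dest: in_set_dropD)
        then show ?thesis using p[OF that(2)] by (auto simp: Q_def)
      qed
      have n_pos: "0 < n i" if "i \<in> I" for i using I(2)[OF that] N0 by linarith
      have letter_pos: "0 < letter w" if "w \<in> words A N" for w
        using p_pos[OF that, of "N - 1"] False cA by (simp add: letter_def)
      have block_pos: "0 < block i w" if "w \<in> words A N" "i \<in> J" for i w
        using p_pos[OF that(1), of "N - n i"] that n_pos[of i] lam_pos
        unfolding block_def by (intro mult_pos_pos) (auto simp: J_def)
      have "(\<Sum>w\<in>words A N. letter w) \<le> 1 / 2"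
      proof -
        obtain M where M: "N = Suc M" using False by (cases N) auto
        have "(\<Sum>w\<in>words A N. letter w) = (\<Sum>a\<in>A. 1 / (2 * real (card A)) * (\<Sum>w\<in>words A M. p M w))"
          unfolding M sum_words_Suc letter_def by (simp add: M sum_distrib_left)
        also have "\<dots> = (\<Sum>w\<in>words A M. p M w) / 2" using cA by simp
        also have "\<dots> \<le> 1 / 2" using p[of M] by (simp add: M Q_def)
        finally show ?thesis .
      qed
      moreover have "(\<Sum>w\<in>words A N. \<Sum>i\<in>J. block i w) \<le> 1 / 2"
      proof -
        have "(\<Sum>w\<in>words A N. block i w) \<le> 1 / 2 * exp (- \<alpha> * real (n i))" if i: "i \<in> J" for i
        proof -
          let ?m = "n i" and ?r = "N - n i"
          have N: "N = ?m + ?r" "?r < N" using i n_pos[of i] False by (auto simp: J_def)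
          have pr: "0 \<le> (\<Sum>w\<in>words A ?r. p ?r w)" "(\<Sum>w\<in>words A ?r. p ?r w) \<le> 1"
            using p[OF N(2)] by (auto simp: Q_def intro: sum_nonneg less_imp_le)
          have "(\<Sum>w\<in>words A N. block i w) = (\<Sum>w\<in>words A (?m + ?r). block i w)" using N(1) by simp
          also have "\<dots> = (\<Sum>v\<in>words A ?m. \<Sum>w\<in>words A ?r. 1 / 2 * exp (- \<alpha> * real ?m) * (lam i v * p ?r w))"
            unfolding sum_words_add by (intro sum.cong refl) (auto simp: block_def words_def)
          also have "\<dots> = 1 / 2 * exp (- \<alpha> * real ?m) * ((\<Sum>v\<in>words A ?m. lam i v) * (\<Sum>w\<in>words A ?r. p ?r w))"
            unfolding sum_product by (simp only: sum_distrib_left)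
          also have "\<dots> \<le> 1 / 2 * exp (- \<alpha> * real ?m) * (1 * 1)"
            using pr lam_sum by (intro mult_left_mono mult_mono) auto
          finally show ?thesis by simp
        qed
        then have "(\<Sum>i\<in>J. \<Sum>w\<in>words A N. block i w) \<le> (\<Sum>i\<in>J. 1 / 2 * exp (- \<alpha> * real (n i)))"
          by (intro sum_mono) auto
        also have "\<dots> \<le> (\<Sum>i\<in>I. 1 / 2 * exp (- \<alpha> * real (n i)))"
          by (rule sum_mono2) (use J I in auto)
        also have "\<dots> = 1 / 2 * (\<Sum>i\<in>I. exp (- \<alpha> * real (n i)))" by (simp only: sum_distrib_left)
        also have "\<dots> \<le> 1 / 2" using weight by linarith
        finally show ?thesis by (subst sum.swap)
      qed
      ultimately have q_sum: "(\<Sum>w\<in>words A N. q w) \<le> 1"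
        by (simp add: q_def sum.distrib)
      have q_letter: "letter w \<le> q w" and q_block: "i \<in> J \<Longrightarrow> block i w \<le> q w" if "w \<in> words A N" for i w
      proof -
        have nn: "0 \<le> block i w" if "i \<in> J" for i using block_pos[OF \<open>w \<in> words A N\<close> that] by simp
        then show "letter w \<le> q w" by (auto simp: q_def intro: sum_nonneg)
        show "block i w \<le> q w" if "i \<in> J"
          using member_le_sum[of i J "\<lambda>i. block i w"] nn that J letter_pos[OF \<open>w \<in> words A N\<close>]
          by (auto simp: q_def)
      qed
      have "- ln (q (itinerary f \<xi> N x)) \<le> a * real N + (\<Sum>t<N. b ((f ^^ t) x)) + \<kappa> * real (min N L)" for x
      proof (cases "\<exists>i\<in>J. x \<in> B i")
        case True
        then obtain i where i: "i \<in> J" "x \<in> B i" by auto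
        let ?m = "n i" and ?r = "N - n i"
        have N: "N = ?m + ?r" "?r < N" and iI: "i \<in> I" using i n_pos[of i] False by (auto simp: J_def)
        let ?w = "itinerary f \<xi> N x"
        let ?v = "itinerary f \<xi> ?m x" and ?z = "itinerary f \<xi> ?r ((f ^^ ?m) x)"
        have w: "?w = ?v @ ?z" using itinerary_add[of f \<xi> ?m ?r x] N(1) by simp
        have pz: "0 < p ?r ?z" using p[OF N(2)] itinerary_in by (auto simp: Q_def)
        have "- ln (q ?w) \<le> - ln (block i ?w)"
          using q_block[OF itinerary_in i(1)] block_pos[OF itinerary_in i(1)] by (simp add: ln_mono)
        also have "block i ?w = 1 / 2 * exp (- \<alpha> * real ?m) * lam i ?v * p ?r ?z"
          by (simp add: block_def w)
        also have "- ln \<dots> = ln 2 + \<alpha> * real ?m - ln (lam i ?v) - ln (p ?r ?z)"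
          using lam_pos[of i ?v] pz by (simp add: ln_mult ln_div)
        also have "\<dots> \<le> ln 2 + \<alpha> * real ?m + (c * real ?m + (\<Sum>t<?m. b ((f ^^ t) x)))
          + (a * real ?r + (\<Sum>t<?r. b ((f ^^ t) ((f ^^ ?m) x))) + \<kappa> * real (min ?r L))"
        proof -
          have "- ln (p ?r ?z) \<le> a * real ?r + (\<Sum>t<?r. b ((f ^^ t) ((f ^^ ?m) x))) + \<kappa> * real (min ?r L)"
            using p[OF N(2)] unfolding Q_def by blast
          then show ?thesis using lam_cost[OF iI i(2)] by linarith
        qed
        also have "\<dots> \<le> a * real N + (\<Sum>t<N. b ((f ^^ t) x)) + \<kappa> * real (min N L)"
        proof -
          \<comment> \<open>The factor 1/2 of a block costs ln 2. Spread over the at least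
            \<open>N\<^sub>0\<close> letters of the block, this is the last summand of
            \<open>a\<close>.\<close>
          have "real N\<^sub>0 \<le> real ?m" using I(2)[OF iI] by simp
          then have "ln 2 * real N\<^sub>0 \<le> ln 2 * real ?m" by (intro mult_left_mono) auto
          then have "ln 2 \<le> ln 2 / real N\<^sub>0 * real ?m" using N0 by (simp add: field_simps)
          then have "ln 2 + \<alpha> * real ?m + c * real ?m \<le> a * real ?m" by (simp add: a_def c_def algebra_simps)
          moreover have "a * real N = a * real ?m + a * real ?r"
            using N(1) by (metis distrib_left of_nat_add)
          moreover have "(\<Sum>t<N. b ((f ^^ t) x)) = (\<Sum>t<?m. b ((f ^^ t) x)) + (\<Sum>t<?r. b ((f ^^ t) ((f ^^ ?m) x)))"
            using sum_lessThan_add[of "\<lambda>t. b ((f ^^ t) x)" ?m ?r] N(1)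
            by (simp add: funpow_add add.commute[of ?m])
          moreover have "\<kappa> * real (min ?r L) \<le> \<kappa> * real (min N L)"
            using \<kappa> by (intro mult_left_mono) auto
          ultimately show ?thesis by linarith
        qed
        finally show ?thesis .
      next
        case no_block: False
        obtain M where M: "N = Suc M" using False by (cases N) auto
        let ?w = "itinerary f \<xi> N x" and ?z = "itinerary f \<xi> M (f x)"
        have pz: "0 < p M ?z" using p[of M] itinerary_in by (auto simp: Q_def M)
        have "- ln (q ?w) \<le> - ln (letter ?w)"
          using q_letter[OF itinerary_in] letter_pos[OF itinerary_in] by (simp add: ln_mono)
        also have "letter ?w = 1 / (2 * real (card A)) * p M ?z"
          by (simp add: letter_def M itinerary_Suc)
        also have "- ln \<dots> = \<kappa> - ln (p M ?z)"
          using pz cA by (simp add: \<kappa>_def ln_mult ln_div)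
        also have "\<dots> \<le> \<kappa> + (a * real M + (\<Sum>t<M. b ((f ^^ t) (f x))) + \<kappa> * real (min M L))"
        proof -
          have "M < N" using M by simp
          then have "- ln (p M ?z) \<le> a * real M + (\<Sum>t<M. b ((f ^^ t) (f x))) + \<kappa> * real (min M L)"
            using p unfolding Q_def by blast
          then show ?thesis by simp
        qed
        also have "\<dots> \<le> a * real N + (\<Sum>t<N. b ((f ^^ t) x)) + \<kappa> * real (min N L)"
        proof -
          have sumb: "(\<Sum>t<N. b ((f ^^ t) x)) = b x + (\<Sum>t<M. b ((f ^^ t) (f x)))"
            unfolding M by (subst sum.lessThan_Suc_shift) (simp add: funpow_swap1)
          have "\<kappa> + \<kappa> * real (min M L) \<le> b x + \<kappa> * real (min N L)"
          proof (cases "x \<in> (\<Union>i\<in>I. B i)")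
            case True
            then obtain i where "i \<in> I" "x \<in> B i" by auto
            \<comment> \<open>A point of \<open>B i\<close> is read as a letter only if its block
              overruns the end of the word. Then \<open>N \<le> L\<close>, so removing the letter
              lowers \<open>min N L\<close> by one, which pays for it.\<close>
            then have "N < n i" using no_block by (auto simp: J_def not_le)
            then have "N \<le> L" using I(3)[OF \<open>i \<in> I\<close>] by simp
            then show ?thesis using b(3)[of x] by (simp add: M algebra_simps)
          next
            case False
            then have "\<kappa> \<le> b x" using b(2)[of x] by simp
            moreover have "\<kappa> * real (min M L) \<le> \<kappa> * real (min N L)"
              using \<kappa> by (intro mult_left_mono) (auto simp: M)
            ultimately show ?thesis by simp
          qed
          then show ?thesis using a unfolding sumb by (simp add: M algebra_simps)
        qed
        finally show ?thesis .
      qed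
      then have "Q N q"
        using q_sum letter_pos q_letter by (auto simp: Q_def intro: less_le_trans)
      then show ?thesis by blast
    qed
  qed
  then show ?thesis by (simp add: Q_def b_def)
qed

text \<open>Four errors of \<delta> / 4 each add up: copying with weight 1 - \<theta>, the choice
  between block and letter, errors outside \<open>K\<close>, and single letters outside the chosen
  balls. The end term \<kappa> L disappears after division by \<open>N\<close>. The scale has to be
  fixed before the set and the exponent, since those are obtained from the pressure at that
  scale.\<close>

lemma (in coding_measure) entropy_rate_le_cover_sum:
  assumes cpt: "compact (UNIV :: 'a set)" and \<delta>: "0 < \<delta>"
  obtains \<epsilon> where "0 < \<epsilon>"
    "\<And>Z \<alpha>. Z \<in> sets borel \<Longrightarrow> prob Z = 1 \<Longrightarrow> (\<And>N. cover_sum f Z \<alpha> N \<epsilon> < 1) \<Longrightarrow> entropy_rate \<le> \<alpha> + \<delta>"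
proof -
  define \<theta> where "\<theta> = 1 - exp (- \<delta> / 4)"
  have \<theta>: "0 < \<theta>" "\<theta> < 1" and ln\<theta>: "- ln (1 - \<theta>) = \<delta> / 4" using \<delta> by (auto simp: \<theta>_def)
  define \<kappa> where "\<kappa> = ln (2 * real (card A))"
  define \<kappa>' where "\<kappa>' = ln (real (card A) / \<theta>)"
  have cA: "1 \<le> real (card A)" using card_A by linarith
  have \<kappa>: "0 < \<kappa>" using cA by (simp add: \<kappa>_def)
  have \<kappa>': "0 < \<kappa>'" unfolding \<kappa>'_def using \<theta> cA by (intro ln_gt_zero) (simp add: less_divide_eq)
  obtain K \<epsilon> u where K: "K \<in> sets borel" "prob (- K) \<le> \<delta> / (4 * \<kappa>')" and \<epsilon>: "0 < \<epsilon>"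
    and u: "\<And>x y. dist x y < \<epsilon> \<Longrightarrow> y \<in> K \<Longrightarrow> \<xi> y = u x"
    using code_locally_constant[OF cpt, of "\<delta> / (4 * \<kappa>')"] \<delta> \<kappa>' by auto
  show thesis
  proof (rule that[OF \<epsilon>])
    fix Z \<alpha> assume Z: "Z \<in> sets borel" "prob Z = 1" and cov: "\<And>N. cover_sum f Z \<alpha> N \<epsilon> < 1"
    \<comment> \<open>Makes \<open>ln 2 / N\<^sub>0\<close> at most \<delta> / 4. The assumption on
      cover sums, taken at this length, supplies blocks that are long enough.\<close>
    define N\<^sub>0 where "N\<^sub>0 = Suc (nat \<lceil>4 / \<delta>\<rceil>)"
    have "4 / \<delta> \<le> real N\<^sub>0" unfolding N\<^sub>0_def by linarith
    then have "4 \<le> \<delta> * real N\<^sub>0" using \<delta> by (simp add: divide_le_eq mult.commute)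
    moreover have "ln 2 \<le> (1::real)" using ln_le_minus_one[of 2] by simp
    ultimately have N0: "ln 2 / real N\<^sub>0 \<le> \<delta> / 4" by (simp add: N\<^sub>0_def field_simps)
    obtain J :: "nat set" and x n where J: "Z \<subseteq> (\<Union>i\<in>J. bowen_ball f (n i) (x i) \<epsilon>)"
      "\<And>i. i \<in> J \<Longrightarrow> N\<^sub>0 \<le> n i" "(\<Sum>\<^sub>\<infinity>i\<in>J. ennreal (exp (- \<alpha> * real (n i)))) < 1"
      by (rule cover_sum_lessE[OF cov]) (rule that)
    have weight: "(\<Sum>i\<in>F. exp (- \<alpha> * real (n i))) < 1" if "finite F" "F \<subseteq> J" for F
    proof -
      have "ennreal (\<Sum>i\<in>F. exp (- \<alpha> * real (n i))) = (\<Sum>i\<in>F. ennreal (exp (- \<alpha> * real (n i))))"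
        by (rule sum_ennreal[symmetric]) simp
      also have "\<dots> < 1" using sum_le_infsum_ennreal[OF that] J(3) by (rule le_less_trans)
      finally show ?thesis by (simp add: ennreal_less_one_iff)
    qed
    have "Z \<noteq> {}" using Z(2) by auto
    then obtain j where "j \<in> J" using J(1) by blast
    \<comment> \<open>With a negative exponent every ball would have weight at least 1, whereas the
      total is below 1 and a cover of the non-empty \<open>Z\<close> has at least one
      member.\<close>
    have \<alpha>: "0 \<le> \<alpha>"
    proof (rule ccontr)
      assume "\<not> 0 \<le> \<alpha>"
      then have "0 \<le> - \<alpha> * real (n j)" by (simp add: mult_nonpos_nonneg)
      moreover have "exp (- \<alpha> * real (n j)) < 1" using weight[of "{j}"] \<open>j \<in> J\<close> by simp
      ultimately show False by simp
    qed
    define B where "B i = bowen_ball f (n i) (x i) \<epsilon>" for i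
    have B: "B i \<in> sets borel" for i
    proof -
      have "B i = (\<Inter>t\<in>{..<n i}. (f ^^ t) -` ball ((f ^^ t) (x i)) \<epsilon>)"
        by (auto simp: B_def bowen_ball_def)
      moreover have "(f ^^ t) -` ball ((f ^^ t) (x i)) \<epsilon> \<in> sets borel" for t
        using measurable_sets[OF funpow_borel, of "ball ((f ^^ t) (x i)) \<epsilon>" t] by simp
      ultimately show ?thesis by (cases "n i = 0") (auto intro!: sets.finite_INT)
    qed
    \<comment> \<open>The weights need a finite family, with a common bound \<open>L\<close> on the
      lengths. Truncating the cover leaves an exceptional set of small measure, which is paid for
      letter by letter.\<close>
    define G where "G m = (\<Union>i\<in>J \<inter> {..<m}. B i)" for m
    have G: "G m \<in> sets borel" for m unfolding G_def using B by auto
    have "(\<lambda>m. prob (G m)) \<longlonglongrightarrow> prob (\<Union>m. G m)"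
      by (rule finite_Lim_measure_incseq) (use G in \<open>auto simp: incseq_def G_def\<close>)
    moreover have "prob (\<Union>m. G m) = 1"
    proof -
      have "Z \<subseteq> (\<Union>m. G m)" using J(1) by (force simp: G_def B_def)
      then have "prob Z \<le> prob (\<Union>m. G m)"
        by (rule finite_measure_mono) (use G in auto)
      then show ?thesis using Z(2) prob_le_1[of "\<Union>m. G m"] by linarith
    qed
    ultimately have "(\<lambda>m. prob (G m)) \<longlonglongrightarrow> 1" by simp
    from order_tendstoD(1)[OF this, of "1 - \<delta> / (4 * \<kappa>)"] \<delta> \<kappa>
    obtain m where m: "1 - \<delta> / (4 * \<kappa>) < prob (G m)" by (auto simp: eventually_sequentially)
    define I where "I = J \<inter> {..<m}"
    have I: "finite I" "I \<subseteq> J" by (auto simp: I_def)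
    have GI: "G m = (\<Union>i\<in>I. B i)" by (simp add: G_def I_def)
    have probG: "prob (- G m) < \<delta> / (4 * \<kappa>)"
      using prob_compl[of "G m"] m G by (simp add: Compl_eq_Diff_UNIV)
    define L where "L = (\<Sum>i\<in>I. n i)"
    define a where "a = \<alpha> - ln (1 - \<theta>) + ln 2 / real N\<^sub>0"
    define b where "b y = \<kappa>' * indicator (- K) y + \<kappa> * indicator (- G m) y" for y
    have b_meas: "b \<in> borel_measurable borel" unfolding b_def using K(1) G[of m] by measurable
    have int_b: "integrable \<mu> (\<lambda>y. b ((f ^^ t) y))" for t
      by (rule integrable_const_bound[of _ "\<kappa>' + \<kappa>"])
        (use \<kappa> \<kappa>' measurable_compose[OF funpow_borel b_meas] in \<open>auto simp: b_def indicator_def measurable_mu\<close>)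
    have "(LINT y|\<mu>. b y) = (LINT y|\<mu>. \<kappa>' * indicator (- K) y) + (LINT y|\<mu>. \<kappa> * indicator (- G m) y)"
      unfolding b_def using K(1) G[of m]
      by (intro Bochner_Integration.integral_add integrable_mult_right integrable_real_indicator)
        (auto simp: less_top[symmetric])
    also have "\<dots> = \<kappa>' * prob (- K) + \<kappa> * prob (- G m)" by simp
    also have "\<dots> \<le> \<kappa>' * (\<delta> / (4 * \<kappa>')) + \<kappa> * (\<delta> / (4 * \<kappa>))"
      using K(2) probG \<kappa> \<kappa>' by (intro add_mono mult_left_mono) auto
    also have "\<dots> = \<delta> / 2" using \<kappa> \<kappa>' by simp
    finally have int_b_le: "(LINT y|\<mu>. b y) \<le> \<delta> / 2" .
    have "block_entropy N / real N \<le> a + \<delta> / 2 + \<kappa> * real L / real N" if "0 < N" for N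
    proof -
      let ?g = "\<lambda>y. a * real N + (\<Sum>t<N. b ((f ^^ t) y)) + \<kappa> * real (min N L)"
      have "\<exists>q. (\<forall>w\<in>words A N. 0 < q w) \<and> (\<Sum>w\<in>words A N. q w) \<le> 1 \<and>
          (\<forall>y. - ln (q (itinerary f \<xi> N y)) \<le> ?g y)"
        unfolding a_def b_def \<kappa>_def \<kappa>'_def GI
      proof (rule block_weights[where u = "\<lambda>i t. u ((f ^^ t) (x i))"])
        show "N\<^sub>0 \<le> n i" if "i \<in> I" for i using J(2) I that by auto
        show "n i \<le> L" if "i \<in> I" for i unfolding L_def using I that by (intro member_le_sum) auto
        show "(\<Sum>i\<in>I. exp (- \<alpha> * real (n i))) \<le> 1" using weight[OF I] by simp
        show "\<xi> ((f ^^ t) y) = u ((f ^^ t) (x i))" if "y \<in> B i" "t < n i" "(f ^^ t) y \<in> K" for i y t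
          using that by (intro u) (auto simp: B_def bowen_ball_def)
      qed (use I \<alpha> \<theta> in \<open>auto simp: N\<^sub>0_def\<close>)
      then obtain q where q: "\<forall>w\<in>words A N. 0 < q w" "(\<Sum>w\<in>words A N. q w) \<le> 1"
        "\<forall>y. - ln (q (itinerary f \<xi> N y)) \<le> ?g y" by auto
      have int_sum: "integrable \<mu> (\<lambda>y. \<Sum>t<N. b ((f ^^ t) y))"
        by (intro Bochner_Integration.integrable_sum int_b)
      have "block_entropy N \<le> (LINT y|\<mu>. ?g y)"
        by (rule block_entropy_le_integral[of _ q]) (use q int_sum in auto)
      also have "\<dots> = a * real N + (LINT y|\<mu>. (\<Sum>t<N. b ((f ^^ t) y))) + \<kappa> * real (min N L)"
        using int_sum prob_space by simp
      also have "(LINT y|\<mu>. (\<Sum>t<N. b ((f ^^ t) y))) = (\<Sum>t<N. (LINT y|\<mu>. b ((f ^^ t) y)))"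
        by (intro Bochner_Integration.integral_sum int_b)
      also have "\<dots> = real N * (LINT y|\<mu>. b y)"
        by (simp add: integral_funpow[OF invariant b_meas])
      also have "a * real N + real N * (LINT y|\<mu>. b y) + \<kappa> * real (min N L)
          \<le> a * real N + real N * (\<delta> / 2) + \<kappa> * real L"
        using int_b_le \<kappa> by (intro add_mono[OF add_mono[OF order_refl]] mult_left_mono) auto
      finally have "block_entropy N / real N \<le> (a * real N + real N * (\<delta> / 2) + \<kappa> * real L) / real N"
        by (rule divide_right_mono) simp
      also have "\<dots> = a + \<delta> / 2 + \<kappa> * real L / real N"
        using that by (simp add: field_simps)
      finally show ?thesis .
    qed
    then have "\<exists>M. \<forall>N\<ge>M. block_entropy N / real N \<le> a + \<delta> / 2 + \<kappa> * real L / real N"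
      by (intro exI[of _ 1]) auto
    moreover have "(\<lambda>N. a + \<delta> / 2 + \<kappa> * real L / real N) \<longlonglongrightarrow> a + \<delta> / 2 + 0"
      by (intro tendsto_add tendsto_const lim_const_over_n)
    ultimately have "entropy_rate \<le> a + \<delta> / 2 + 0"
      by (intro LIMSEQ_le[OF entropy_rate_LIMSEQ])
    then show "entropy_rate \<le> \<alpha> + \<delta>" using N0 ln\<theta> unfolding a_def by linarith
  qed
qed

section \<open>Ergodic decompositions\<close>

lemma ergodic_imp_invariant: "\<nu> \<in> ergodic_measures f \<Longrightarrow> \<nu> \<in> invariant_measures f"
  by (simp add: ergodic_measures_def)

section \<open>Entropy and pressure of a single measure\<close>

lemma entropy_wrt_partition_le_ks_entropy:
  assumes "\<mu> \<in> invariant_measures f" "finite P" "P \<subseteq> sets borel" "partition_on UNIV P"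
  shows "ereal (entropy_wrt_partition \<mu> f P) \<le> ks_entropy \<mu> f"
  unfolding ks_entropy_def
  by (rule SUP_upper) (use assms invariant_measuresD(2,3)[OF assms(1)] in auto)

lemma measure_pressure_le:
  assumes "\<And>k. measure_pressure_at f \<mu> (1 / real (Suc k)) \<le> c"
  shows "measure_pressure f \<mu> \<le> c"
  unfolding measure_pressure_eq_SUP
proof (rule SUP_least)
  fix \<epsilon> :: real assume "\<epsilon> \<in> {0<..}"
  then obtain k where "inverse (real (Suc k)) < \<epsilon>" using reals_Archimedean by auto
  then have "1 / real (Suc k) \<le> \<epsilon>" by (simp add: inverse_eq_divide)
  then show "measure_pressure_at f \<mu> \<epsilon> \<le> c"
    using measure_pressure_at_antimono assms order_trans by blast
qed

theorem ks_entropy_le_measure_pressure: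
  fixes f :: "'a::metric_space \<Rightarrow> 'a"
  assumes cpt: "compact (UNIV :: 'a set)" and inv: "\<mu> \<in> invariant_measures f"
  shows "ks_entropy \<mu> f \<le> measure_pressure f \<mu>"
  unfolding ks_entropy_def
proof (rule SUP_least)
  fix P assume "P \<in> {P. finite P \<and> P \<subseteq> sets \<mu> \<and> partition_on (space \<mu>) P}"
  then have P: "finite P" "P \<subseteq> sets borel" "partition_on UNIV P"
    using invariant_measuresD(2,3)[OF inv] by auto
  interpret coding_measure f "cell P" P \<mu> by (rule coding_measure_cell[OF inv P])
  show "ereal (entropy_wrt_partition \<mu> f P) \<le> measure_pressure f \<mu>"
    unfolding entropy_wrt_partition_eq[OF inv P]
  proof (rule ccontr)
    assume "\<not> ereal entropy_rate \<le> measure_pressure f \<mu>"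
    then have "measure_pressure f \<mu> < ereal entropy_rate" by simp
    then obtain r where r: "measure_pressure f \<mu> < ereal r" "r < entropy_rate"
      using ereal_dense2 by (metis less_ereal.simps(1))
    \<comment> \<open>The whole gap \<open>entropy_rate - r\<close> serves as \<delta>, so that any
      admissible exponent below \<open>r\<close> gives a contradiction.\<close>
    obtain \<epsilon> where \<epsilon>: "0 < \<epsilon>" and le: "\<And>Z \<alpha>. Z \<in> sets borel \<Longrightarrow> prob Z = 1 \<Longrightarrow>
        (\<And>N. cover_sum f Z \<alpha> N \<epsilon> < 1) \<Longrightarrow> entropy_rate \<le> \<alpha> + (entropy_rate - r)"
      using entropy_rate_le_cover_sum[OF cpt, of "entropy_rate - r"] r by auto
    have "measure_pressure_at f \<mu> \<epsilon> < ereal r"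
      using r(1) \<epsilon> unfolding measure_pressure_eq_SUP by (meson SUP_upper greaterThan_iff le_less_trans)
    then obtain Z where Z: "Z \<in> sets \<mu>" "emeasure \<mu> Z = 1" "set_pressure f Z \<epsilon> < ereal r"
      unfolding measure_pressure_at_def Inf_less_iff by auto
    then obtain \<alpha> where \<alpha>: "cover_limit f Z \<alpha> \<epsilon> = 0" "\<alpha> < r"
      unfolding set_pressure_def Inf_less_iff by auto
    have "entropy_rate \<le> \<alpha> + (entropy_rate - r)"
    proof (rule le)
      show "Z \<in> sets borel" using Z(1) by simp
      show "prob Z = 1" using Z(2) by (simp add: emeasure_eq_measure)
      show "cover_sum f Z \<alpha> N \<epsilon> < 1" for N using \<alpha>(1) by (simp add: cover_limit_eq_0_iff)
    qed
    then show False using \<alpha>(2) by simp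
  qed
qed

lemma low_entropy_set:
  fixes f :: "'a::metric_space \<Rightarrow> 'a"
  assumes f: "f \<in> borel_measurable borel" and P: "finite P" "P \<subseteq> sets borel" "partition_on UNIV P"
    and mesh: "\<forall>C\<in>P. \<forall>x\<in>C. \<forall>y\<in>C. dist x y < \<epsilon>"
  obtains Z where "Z \<in> sets borel" "set_pressure f Z \<epsilon> \<le> ereal \<alpha>"
    "\<And>\<nu>. \<nu> \<in> ergodic_measures f \<Longrightarrow> entropy_wrt_partition \<nu> f P < \<alpha> \<Longrightarrow> measure \<nu> Z = 1"
proof -
  interpret coding f "cell P" P by (rule coding_cell[OF f P])
  have small: "dist x y < \<epsilon>" if "cell P x = cell P y" for x y
    using mesh cell_in[OF P(3)] that by metis
  obtain Z where Z: "Z \<in> sets borel" "\<And>\<beta> N. \<alpha> < \<beta> \<Longrightarrow> cover_sum f Z \<beta> N \<epsilon> = 0"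
    "\<And>\<nu>. \<nu> \<in> ergodic_measures f \<Longrightarrow> coding_measure.entropy_rate f (cell P) P \<nu> < \<alpha> \<Longrightarrow> measure \<nu> Z = 1"
    using universal_low_entropy_set[OF small, of \<alpha>] by blast
  show thesis
  proof (rule that[OF Z(1)])
    show "set_pressure f Z \<epsilon> \<le> ereal \<alpha>"
    proof (rule ereal_le_epsilon2)
      fix e :: real assume "0 < e"
      then have "cover_limit f Z (\<alpha> + e) \<epsilon> = 0" using Z(2) by (simp add: cover_limit_eq_0_iff)
      then show "set_pressure f Z \<epsilon> \<le> ereal \<alpha> + ereal e"
        unfolding set_pressure_def by (intro Inf_lower) auto
    qed
    show "measure \<nu> Z = 1" if "\<nu> \<in> ergodic_measures f" "entropy_wrt_partition \<nu> f P < \<alpha>" for \<nu>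
      using that Z(3) entropy_wrt_partition_eq[OF _ P, of \<nu>] by (simp add: ergodic_measures_def)
  qed
qed

lemma measure_pressure_at_le_set_pressure:
  assumes "\<mu> \<in> invariant_measures f" "Z \<in> sets borel" "measure \<mu> Z = 1"
  shows "measure_pressure_at f \<mu> \<epsilon> \<le> set_pressure f Z \<epsilon>"
proof -
  interpret prob_space \<mu> by (rule invariant_measuresD(1)[OF assms(1)])
  have "Z \<in> sets \<mu> \<and> emeasure \<mu> Z = 1"
    using assms invariant_measuresD(2)[OF assms(1)] by (simp add: emeasure_eq_measure)
  then show ?thesis unfolding measure_pressure_at_def by (intro Inf_lower CollectI exI conjI) auto
qed

lemma measure_pressure_at_le_partition:
  fixes f :: "'a::metric_space \<Rightarrow> 'a"
  assumes erg: "\<nu> \<in> ergodic_measures f" and P: "finite P" "P \<subseteq> sets borel" "partition_on UNIV P"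
    and mesh: "\<forall>C\<in>P. \<forall>x\<in>C. \<forall>y\<in>C. dist x y < \<epsilon>"
  shows "measure_pressure_at f \<nu> \<epsilon> \<le> ereal (entropy_wrt_partition \<nu> f P)"
proof (rule ereal_le_epsilon2)
  fix e :: real assume "0 < e"
  have inv: "\<nu> \<in> invariant_measures f" using erg by (rule ergodic_imp_invariant)
  obtain Z where Z: "Z \<in> sets borel" "set_pressure f Z \<epsilon> \<le> ereal (entropy_wrt_partition \<nu> f P + e)"
    "entropy_wrt_partition \<nu> f P < entropy_wrt_partition \<nu> f P + e \<Longrightarrow> measure \<nu> Z = 1"
    by (rule low_entropy_set[OF invariant_measuresD(6)[OF inv] P mesh]) (rule that, use erg in auto)
  have "measure_pressure_at f \<nu> \<epsilon> \<le> set_pressure f Z \<epsilon>"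
    by (rule measure_pressure_at_le_set_pressure) (use inv Z \<open>0 < e\<close> in auto)
  also have "\<dots> \<le> ereal (entropy_wrt_partition \<nu> f P + e)" by (rule Z(2))
  finally show "measure_pressure_at f \<nu> \<epsilon> \<le> ereal (entropy_wrt_partition \<nu> f P) + ereal e" by simp
qed

text \<open>The atoms of a finite cover by balls of radius \<epsilon> / 2; two points of one atom
  lie in a common ball. Only the types \<open>tp x\<close> of actual points are used, which keeps
  the empty set out.\<close>

lemma small_mesh_partition:
  assumes cpt: "compact (UNIV :: 'a::metric_space set)" and "0 < \<epsilon>"
  obtains P :: "'a::metric_space set set" where "finite P" "P \<subseteq> sets borel" "partition_on UNIV P"
    "\<forall>C\<in>P. \<forall>x\<in>C. \<forall>y\<in>C. dist x y < \<epsilon>"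
proof -
  obtain k :: "'a set" where k: "finite k" "UNIV \<subseteq> (\<Union>c\<in>k. ball c (\<epsilon> / 2))"
    using compact_eq_totally_bounded[of "UNIV :: 'a set"] cpt \<open>0 < \<epsilon>\<close> by (meson half_gt_zero)
  define atom where "atom S = {y. \<forall>c\<in>k. y \<in> ball c (\<epsilon> / 2) \<longleftrightarrow> c \<in> S}" for S :: "'a set"
  define tp where "tp x = {c \<in> k. x \<in> ball c (\<epsilon> / 2)}" for x
  have in_at: "x \<in> atom S \<longleftrightarrow> tp x = k \<inter> S" for x S by (auto simp: atom_def tp_def)
  have x_at: "x \<in> atom (tp x)" for x by (auto simp: atom_def tp_def)
  show thesis
  proof (rule that)
    show "finite (atom ` tp ` UNIV)"
      by (rule finite_imageI, rule finite_subset[of _ "Pow k"]) (use k in \<open>auto simp: tp_def\<close>)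
    show "atom ` tp ` UNIV \<subseteq> sets borel"
    proof
      fix C assume "C \<in> atom ` tp ` UNIV"
      then obtain S where C: "C = atom S" by auto
      define V where "V c = (if c \<in> S then ball c (\<epsilon> / 2) else - ball c (\<epsilon> / 2))" for c
      have V: "y \<in> V c \<longleftrightarrow> (y \<in> ball c (\<epsilon> / 2) \<longleftrightarrow> c \<in> S)" for y c by (simp add: V_def)
      have "atom S = (\<Inter>c\<in>k. V c)" unfolding atom_def by (simp only: V set_eq_iff mem_Collect_eq INT_iff simp_thms)
      also have "\<dots> \<in> sets borel"
      proof (rule sets.finite_INT[OF k(1)])
        show "k \<noteq> {}" using k(2) by auto
        show "V c \<in> sets borel" for c by (simp add: V_def)
      qed
      finally show "C \<in> sets borel" by (simp only: C)
    qed
    show "partition_on UNIV (atom ` tp ` UNIV)"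
    proof (rule partition_onI)
      show "\<Union> (atom ` tp ` UNIV) = UNIV" using x_at by blast
      show "disjnt p q" if "p \<in> atom ` tp ` UNIV" "q \<in> atom ` tp ` UNIV" "p \<noteq> q" for p q
      proof -
        from that obtain x y where xy: "p = atom (tp x)" "q = atom (tp y)" by auto
        have "k \<inter> tp z = tp z" for z by (auto simp: tp_def)
        then show ?thesis using xy that(3) by (auto simp: disjnt_iff in_at)
      qed
      show "{} \<notin> atom ` tp ` UNIV" using x_at by blast
    qed
    show "\<forall>C\<in>atom ` tp ` UNIV. \<forall>x\<in>C. \<forall>y\<in>C. dist x y < \<epsilon>"
    proof (intro ballI)
      fix C x y assume that: "C \<in> atom ` tp ` UNIV" "x \<in> C" "y \<in> C"
      obtain c where c: "c \<in> k" "x \<in> ball c (\<epsilon> / 2)" using k(2) by blast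
      have "tp x = tp y" using that by (auto simp: in_at)
      then have "y \<in> ball c (\<epsilon> / 2)" using c by (auto simp: tp_def)
      then show "dist x y < \<epsilon>" using c dist_triangle_half_r[of c x \<epsilon> y] by simp
    qed
  qed
qed

section \<open>Measurability of entropy on the space of invariant measures\<close>

lemma integral_weak_star_measurable:
  fixes \<phi> :: "'a::metric_space \<Rightarrow> real"
  assumes "continuous_on UNIV \<phi>"
  shows "(\<lambda>\<nu>. LINT x|\<nu>. \<phi> x) \<in> borel_measurable (weak_star_borel f)"
proof (rule borel_measurableI)
  fix S :: "real set" assume "open S"
  have "(\<lambda>\<nu>. LINT x|\<nu>. \<phi> x) -` S \<inter> space (weak_star_borel f) = {\<nu> \<in> invariant_measures f. (LINT x|\<nu>. \<phi> x) \<in> S}"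
    by (auto simp: space_weak_star_borel)
  moreover have "openin (weak_star_topology f) {\<nu> \<in> invariant_measures f. (LINT x|\<nu>. \<phi> x) \<in> S}"
    unfolding weak_star_topology_def
    by (rule topology_generated_by_Basis) (use assms \<open>open S\<close> in blast)
  ultimately show "(\<lambda>\<nu>. LINT x|\<nu>. \<phi> x) -` S \<inter> space (weak_star_borel f) \<in> sets (weak_star_borel f)"
    by (auto simp: sets_weak_star_borel)
qed

text \<open>The indicator of a closed set is a bounded pointwise limit of continuous functions,
  whose integrals are weak-star continuous in \<nu>.\<close>

lemma measure_closed_weak_star_measurable:
  assumes "closed (C :: 'a::metric_space set)"
  shows "(\<lambda>\<nu>. measure \<nu> C) \<in> borel_measurable (weak_star_borel f)"
proof (cases "C = {}")
  \<comment> \<open>By convention \<open>infdist x {} = 0\<close>, so for the empty set the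
    functions below would be constantly 1.\<close>
  case False
  define \<phi> where "\<phi> n x = max 0 (1 - real n * infdist x C)" for n and x :: 'a
  show ?thesis
  proof (rule borel_measurable_LIMSEQ_real)
    show "(\<lambda>\<nu>. LINT x|\<nu>. \<phi> n x) \<in> borel_measurable (weak_star_borel f)" for n
      by (rule integral_weak_star_measurable) (auto simp: \<phi>_def intro!: continuous_intros)
    fix \<nu> assume "\<nu> \<in> space (weak_star_borel f)"
    then have inv: "\<nu> \<in> invariant_measures f" by (simp add: space_weak_star_borel)
    note nu = invariant_measuresD[OF inv]
    interpret prob_space \<nu> by (rule nu(1))
    have "(\<lambda>n. LINT x|\<nu>. \<phi> n x) \<longlonglongrightarrow> (LINT x|\<nu>. indicator C x)"
    proof (rule integral_dominated_convergence[where w = "\<lambda>_. 1"])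
      show "indicator C \<in> borel_measurable \<nu>" using assms nu by (intro borel_measurable_indicator) simp
      show "\<phi> n \<in> borel_measurable \<nu>" for n
        unfolding measurable_cong_sets[OF nu(2) refl] \<phi>_def
        by (intro borel_measurable_continuous_onI continuous_intros)
      show "AE x in \<nu>. norm (\<phi> n x) \<le> 1" for n by (auto simp: \<phi>_def infdist_nonneg)
      show "AE x in \<nu>. (\<lambda>n. \<phi> n x) \<longlonglongrightarrow> indicator C x"
      proof (rule AE_I2)
        fix x
        show "(\<lambda>n. \<phi> n x) \<longlonglongrightarrow> indicator C x"
        proof (cases "x \<in> C")
          case True
          then show ?thesis by (simp add: \<phi>_def)
        next
          case x: False
          then have "infdist x C \<noteq> 0" using in_closed_iff_infdist_zero[OF assms False] by simp
          then have pos: "0 < infdist x C" using infdist_nonneg[of x C] by linarith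
          obtain n\<^sub>0 :: nat where n0: "1 / infdist x C < real n\<^sub>0" using reals_Archimedean2 by blast
          have "\<phi> n x = 0" if "n\<^sub>0 \<le> n" for n
          proof -
            have "1 / infdist x C < real n" using n0 that by (meson less_le_trans of_nat_mono)
            then have "1 < real n * infdist x C" using pos by (simp add: divide_less_eq)
            then show ?thesis by (simp add: \<phi>_def)
          qed
          then have "\<forall>\<^sub>F n in sequentially. \<phi> n x = 0" by (auto simp: eventually_sequentially)
          then show ?thesis using x by (simp add: tendsto_eventually)
        qed
      qed
    qed simp
    then show "(\<lambda>n. LINT x|\<nu>. \<phi> n x) \<longlonglongrightarrow> measure \<nu> C" using nu by simp
  qed
qed simp

text \<open>Closed sets form an intersection-stable generator of the Borel sets. Measurability
  passes to complements because every \<nu> has total mass 1, and to disjoint unions by countable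
  additivity.\<close>

lemma measure_weak_star_measurable:
  fixes B :: "'a::metric_space set"
  assumes "B \<in> sets borel"
  shows "(\<lambda>\<nu>. measure \<nu> B) \<in> borel_measurable (weak_star_borel f)"
proof -
  have B: "B \<in> sigma_sets UNIV (Collect closed)" using assms by (simp add: borel_eq_closed)
  have sets: "C \<in> sets \<nu>" if "C \<in> sigma_sets UNIV (Collect closed)" "\<nu> \<in> invariant_measures f" for C \<nu>
    using that invariant_measuresD(2)[OF that(2)] by (simp add: borel_eq_closed)
  have "Int_stable (Collect closed :: 'a set set)" by (auto simp: Int_stable_def)
  then show ?thesis
    using _ B
  proof (rule sigma_sets_induct_disjoint)
    fix C :: "'a set" assume C: "C \<in> sigma_sets UNIV (Collect closed)"
      and IH: "(\<lambda>\<nu>. measure \<nu> C) \<in> borel_measurable (weak_star_borel f)"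
    have "measure \<nu> (UNIV - C) = 1 - measure \<nu> C" if "\<nu> \<in> space (weak_star_borel f)" for \<nu>
    proof -
      have inv: "\<nu> \<in> invariant_measures f" using that by (simp add: space_weak_star_borel)
      show ?thesis
        using prob_space.prob_compl[OF invariant_measuresD(1)[OF inv] sets[OF C inv]] invariant_measuresD(3)[OF inv]
        by simp
    qed
    then show "(\<lambda>\<nu>. measure \<nu> (UNIV - C)) \<in> borel_measurable (weak_star_borel f)"
      using IH by (simp cong: measurable_cong)
  next
    fix C :: "nat \<Rightarrow> 'a set" assume C: "disjoint_family C" "range C \<subseteq> sigma_sets UNIV (Collect closed)"
      and IH: "\<And>i. (\<lambda>\<nu>. measure \<nu> (C i)) \<in> borel_measurable (weak_star_borel f)"
    have "measure \<nu> (\<Union>i. C i) = (\<Sum>i. measure \<nu> (C i))" if "\<nu> \<in> space (weak_star_borel f)" for \<nu>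
    proof -
      have inv: "\<nu> \<in> invariant_measures f" using that by (simp add: space_weak_star_borel)
      interpret prob_space \<nu> by (rule invariant_measuresD(1)[OF inv])
      show ?thesis
        by (rule sums_unique, rule finite_measure_UNION) (use C sets[OF _ inv] in auto)
    qed
    then show "(\<lambda>\<nu>. measure \<nu> (\<Union>i. C i)) \<in> borel_measurable (weak_star_borel f)"
      using borel_measurable_suminf[OF IH] by (simp cong: measurable_cong)
  qed (auto intro: measure_closed_weak_star_measurable)
qed

text \<open>The join depends on \<nu> only through its space, which is \<open>UNIV\<close> for all
  of them. Hence partition entropies are expressions in finitely many evaluations at fixed Borel
  sets, and the rate is a limit of these.\<close>

lemma entropy_wrt_partition_measurable:
  fixes f :: "'a::metric_space \<Rightarrow> 'a"
  assumes f: "f \<in> borel_measurable borel" and P: "finite P" "P \<subseteq> sets borel" "partition_on UNIV P"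
  shows "(\<lambda>\<nu>. entropy_wrt_partition \<nu> f P) \<in> borel_measurable (weak_star_borel f)"
proof -
  interpret coding f "cell P" P by (rule coding_cell[OF f P])
  let ?J = "\<lambda>n. (\<lambda>w. itinerary f (cell P) n -` {w}) ` words P n - {{}}"
  have "(\<lambda>\<nu>. measure \<nu> C) \<in> borel_measurable (weak_star_borel f)" if "C \<in> ?J n" for C n
    using that itinerary_borel by (auto intro: measure_weak_star_measurable)
  then have "(\<lambda>\<nu>. lim (\<lambda>n. partition_entropy \<nu> (?J n) / real n)) \<in> borel_measurable (weak_star_borel f)"
    unfolding partition_entropy_def
    by (intro borel_measurable_lim_metric borel_measurable_divide borel_measurable_uminus
        borel_measurable_sum borel_measurable_times borel_measurable_ln borel_measurable_const) auto
  moreover have "entropy_wrt_partition \<nu> f P = lim (\<lambda>n. partition_entropy \<nu> (?J n) / real n)"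
    if "\<nu> \<in> space (weak_star_borel f)" for \<nu>
  proof -
    have "space \<nu> = UNIV" using that by (simp add: space_weak_star_borel invariant_measuresD(3))
    then show ?thesis unfolding entropy_wrt_partition_def by (simp only: iterated_join_eq[OF _ P(3)])
  qed
  ultimately show ?thesis by (simp cong: measurable_cong)
qed

text \<open>The lower bound passes from entropy to pressure, and the upper bound at scale 1 / (k +
  1) returns to the entropy of \<open>P k\<close>. No refinement among the partitions is assumed;
  small mesh is enough.\<close>

lemma ergodic_ks_entropy_eq_SUP:
  fixes f :: "'a::metric_space \<Rightarrow> 'a"
  assumes cpt: "compact (UNIV :: 'a set)" and erg: "\<nu> \<in> ergodic_measures f"
    and P: "\<And>k. finite (P k)" "\<And>k. P k \<subseteq> sets borel" "\<And>k. partition_on UNIV (P k)"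
    and mesh: "\<And>k. \<forall>C\<in>P k. \<forall>x\<in>C. \<forall>y\<in>C. dist x y < 1 / real (Suc k)"
  shows "ks_entropy \<nu> f = (SUP k. ereal (entropy_wrt_partition \<nu> f (P k)))"
proof (rule antisym)
  have inv: "\<nu> \<in> invariant_measures f" using erg by (rule ergodic_imp_invariant)
  have "ks_entropy \<nu> f \<le> measure_pressure f \<nu>" by (rule ks_entropy_le_measure_pressure[OF cpt inv])
  also have "\<dots> \<le> (SUP k. ereal (entropy_wrt_partition \<nu> f (P k)))"
  proof (rule measure_pressure_le)
    fix k
    have "measure_pressure_at f \<nu> (1 / real (Suc k)) \<le> ereal (entropy_wrt_partition \<nu> f (P k))"
      by (rule measure_pressure_at_le_partition[OF erg P mesh])
    then show "measure_pressure_at f \<nu> (1 / real (Suc k)) \<le> (SUP k. ereal (entropy_wrt_partition \<nu> f (P k)))"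
      by (rule SUP_upper2[OF UNIV_I])
  qed
  finally show "ks_entropy \<nu> f \<le> (SUP k. ereal (entropy_wrt_partition \<nu> f (P k)))" .
  show "(SUP k. ereal (entropy_wrt_partition \<nu> f (P k))) \<le> ks_entropy \<nu> f"
    by (rule SUP_least) (rule entropy_wrt_partition_le_ks_entropy[OF inv P])
qed

section \<open>Transfer between a measure and its ergodic components\<close>

locale ergodic_decomposition_setting =
  fixes f :: "'a::metric_space \<Rightarrow> 'a" and \<mu> \<tau>
  assumes compact_UNIV: "compact (UNIV :: 'a set)"
    and inv: "\<mu> \<in> invariant_measures f"
    and dec: "ergodic_decomposition f \<mu> \<tau>"
begin

abbreviation "\<tau>\<^sub>E \<equiv> restrict_space \<tau> (ergodic_measures f)"

lemma sets_tau: "sets \<tau> = sets (weak_star_borel f)"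
  using dec by (simp add: ergodic_decomposition_def)

lemma ergodic_sets: "ergodic_measures f \<in> sets \<tau>"
proof (rule ccontr)
  assume "\<not> ?thesis"
  then show False using dec emeasure_notin_sets[of "ergodic_measures f" \<tau>] by (simp add: ergodic_decomposition_def)
qed

lemma space_restrict: "space \<tau>\<^sub>E = ergodic_measures f"
  using sets.sets_into_space[OF ergodic_sets] by (auto simp: space_restrict_space)

lemma prob_space_restrict: "prob_space \<tau>\<^sub>E"
  by (rule prob_spaceI)
    (use dec ergodic_sets in \<open>simp add: space_restrict emeasure_restrict_space ergodic_decomposition_def\<close>)

lemma measurable_restrict:
  "g \<in> borel_measurable (weak_star_borel f) \<Longrightarrow> g \<in> borel_measurable \<tau>\<^sub>E"
  using measurable_cong_sets[OF sets_tau refl] by (auto intro: measurable_restrict_space1)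

lemma measure_eq_integral:
  assumes "Z \<in> sets borel" shows "measure \<mu> Z = (LINT \<nu>|\<tau>\<^sub>E. measure \<nu> Z)"
proof -
  note mu = invariant_measuresD[OF inv]
  interpret prob_space \<mu> by (rule mu(1))
  have "integrable \<mu> (indicator Z :: 'a \<Rightarrow> real)"
    using assms mu by (simp add: less_top[symmetric])
  then have "(LINT x|\<mu>. indicator Z x) = (LINT \<nu>:ergodic_measures f|\<tau>. (LINT x|\<nu>. indicator Z x :: real))"
    using dec unfolding ergodic_decomposition_def by blast
  also have "\<dots> = (LINT \<nu>|\<tau>\<^sub>E. (LINT x|\<nu>. indicator Z x))"
    unfolding set_lebesgue_integral_def
    by (rule integral_restrict_space[symmetric]) (use ergodic_sets in auto)
  also have "\<dots> = (LINT \<nu>|\<tau>\<^sub>E. measure \<nu> Z)"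
  proof (rule Bochner_Integration.integral_cong[OF refl])
    fix \<nu> assume "\<nu> \<in> space \<tau>\<^sub>E"
    then have "\<nu> \<in> invariant_measures f" by (simp add: space_restrict ergodic_imp_invariant)
    then show "(LINT x|\<nu>. indicator Z x) = measure \<nu> Z" using invariant_measuresD(3)[of \<nu> f] by simp
  qed
  finally show ?thesis using mu by simp
qed

text \<open>The non-negative function 1 - \<nu>(Z) integrates to 1 - \<mu>(Z), so the integral
  vanishes exactly when the function vanishes almost everywhere.\<close>

lemma full_measure_iff:
  assumes Z: "Z \<in> sets borel"
  shows "measure \<mu> Z = 1 \<longleftrightarrow> (AE \<nu> in \<tau>\<^sub>E. measure \<nu> Z = 1)"
proof -
  interpret T: prob_space "\<tau>\<^sub>E" by (rule prob_space_restrict)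
  have le1: "measure \<nu> Z \<le> 1" if "\<nu> \<in> space \<tau>\<^sub>E" for \<nu>
    using that invariant_measuresD(1)[OF ergodic_imp_invariant, of \<nu> f] prob_space.prob_le_1[of \<nu> Z]
    by (simp add: space_restrict)
  have meas: "(\<lambda>\<nu>. measure \<nu> Z) \<in> borel_measurable \<tau>\<^sub>E"
    by (rule measurable_restrict[OF measure_weak_star_measurable[OF Z]])
  have int: "integrable \<tau>\<^sub>E (\<lambda>\<nu>. measure \<nu> Z)"
    by (rule T.integrable_const_bound[of _ 1]) (use le1 meas in auto)
  have "(LINT \<nu>|\<tau>\<^sub>E. 1 - measure \<nu> Z) = 1 - measure \<mu> Z"
    using int by (simp add: measure_eq_integral[OF Z] T.prob_space)
  moreover have "(LINT \<nu>|\<tau>\<^sub>E. 1 - measure \<nu> Z) = 0 \<longleftrightarrow> (AE \<nu> in \<tau>\<^sub>E. 1 - measure \<nu> Z = 0)"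
    by (rule integral_nonneg_eq_0_iff_AE) (use int le1 in auto)
  ultimately show ?thesis by auto
qed

text \<open>An upper bound on \<open>esssup\<close> requires a measurable function. The supremum is
  taken over one sequence of partitions, chosen for all ergodic measures together.\<close>

lemma ks_entropy_measurable: "(\<lambda>\<nu>. ks_entropy \<nu> f) \<in> borel_measurable \<tau>\<^sub>E"
proof -
  have "\<exists>P :: 'a set set. finite P \<and> P \<subseteq> sets borel \<and> partition_on UNIV P \<and>
      (\<forall>C\<in>P. \<forall>x\<in>C. \<forall>y\<in>C. dist x y < 1 / real (Suc k))" for k
    using small_mesh_partition[OF compact_UNIV, of "1 / real (Suc k)"] by (metis divide_pos_pos of_nat_0_less_iff zero_less_Suc zero_less_one)
  then obtain P :: "nat \<Rightarrow> 'a set set" where P: "\<And>k. finite (P k)" "\<And>k. P k \<subseteq> sets borel"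
    "\<And>k. partition_on UNIV (P k)"
    "\<And>k. \<forall>C\<in>P k. \<forall>x\<in>C. \<forall>y\<in>C. dist x y < 1 / real (Suc k)" by metis
  have "(\<lambda>\<nu>. SUP k. ereal (entropy_wrt_partition \<nu> f (P k))) \<in> borel_measurable \<tau>\<^sub>E"
    by (intro borel_measurable_SUP borel_measurable_ereal measurable_restrict
        entropy_wrt_partition_measurable P invariant_measuresD(6)[OF inv]) auto
  moreover have "ks_entropy \<nu> f = (SUP k. ereal (entropy_wrt_partition \<nu> f (P k)))" if "\<nu> \<in> space \<tau>\<^sub>E" for \<nu>
    by (rule ergodic_ks_entropy_eq_SUP[OF compact_UNIV _ P]) (use that space_restrict in simp)
  ultimately show ?thesis by (subst measurable_cong)
qed

lemma measure_pressure_eq_esssup: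
  "measure_pressure f \<mu> = esssup \<tau>\<^sub>E (\<lambda>\<nu>. ks_entropy \<nu> f)"
proof (rule antisym)
  let ?s = "esssup \<tau>\<^sub>E (\<lambda>\<nu>. ks_entropy \<nu> f)"
  show "measure_pressure f \<mu> \<le> ?s"
  proof (rule measure_pressure_le)
    fix k
    show "measure_pressure_at f \<mu> (1 / real (Suc k)) \<le> ?s"
    proof (rule ccontr)
      assume "\<not> ?thesis"
      then obtain \<alpha> where \<alpha>: "?s < ereal \<alpha>" "ereal \<alpha> < measure_pressure_at f \<mu> (1 / real (Suc k))"
        using ereal_dense2 by (metis not_le)
      obtain P :: "'a set set" where P: "finite P" "P \<subseteq> sets borel" "partition_on UNIV P"
        "\<forall>C\<in>P. \<forall>x\<in>C. \<forall>y\<in>C. dist x y < 1 / real (Suc k)"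
        using small_mesh_partition[OF compact_UNIV, of "1 / real (Suc k)"] by auto
      obtain Z where Z: "Z \<in> sets borel" "set_pressure f Z (1 / real (Suc k)) \<le> ereal \<alpha>"
        "\<And>\<nu>. \<nu> \<in> ergodic_measures f \<Longrightarrow> entropy_wrt_partition \<nu> f P < \<alpha> \<Longrightarrow> measure \<nu> Z = 1"
        using low_entropy_set[OF invariant_measuresD(6)[OF inv] P, where \<alpha> = \<alpha>] by blast
      \<comment> \<open>Almost every component has entropy below \<alpha>, in particular with
        respect to \<open>P\<close>, and one and the same \<open>Z\<close> is full for all of
        these.\<close>
      have "AE \<nu> in \<tau>\<^sub>E. measure \<nu> Z = 1"
        using esssup_AE[of "\<lambda>\<nu>. ks_entropy \<nu> f" \<tau>\<^sub>E] AE_space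
      proof eventually_elim
        case (elim \<nu>)
        then have erg: "\<nu> \<in> ergodic_measures f" by (simp add: space_restrict)
        then have "\<nu> \<in> invariant_measures f" by (rule ergodic_imp_invariant)
        from entropy_wrt_partition_le_ks_entropy[OF this P(1-3)] elim(1) \<alpha>(1)
        have "ereal (entropy_wrt_partition \<nu> f P) < ereal \<alpha>" by (meson le_less_trans)
        then show ?case using Z(3)[OF erg] by simp
      qed
      then have "measure \<mu> Z = 1" using full_measure_iff[OF Z(1)] by simp
      then have "measure_pressure_at f \<mu> (1 / real (Suc k)) \<le> set_pressure f Z (1 / real (Suc k))"
        by (intro measure_pressure_at_le_set_pressure[OF inv Z(1)])
      then show False using Z(2) \<alpha>(2) by (meson leD order_trans)
    qed
  qed
  show "?s \<le> measure_pressure f \<mu>"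
  proof (rule ccontr)
    assume "\<not> ?thesis"
    then obtain \<alpha> where \<alpha>: "measure_pressure f \<mu> < ereal \<alpha>" "ereal \<alpha> < ?s"
      using ereal_dense2 by (metis not_le)
    have "\<exists>Z. Z \<in> sets borel \<and> measure \<mu> Z = 1 \<and> set_pressure f Z (1 / real (Suc k)) < ereal \<alpha>" for k
    proof -
      have "measure_pressure_at f \<mu> (1 / real (Suc k)) \<le> measure_pressure f \<mu>"
        unfolding measure_pressure_eq_SUP by (rule SUP_upper) simp
      then have "measure_pressure_at f \<mu> (1 / real (Suc k)) < ereal \<alpha>" using \<alpha>(1) by (rule le_less_trans)
      then obtain Z where "Z \<in> sets \<mu>" "emeasure \<mu> Z = 1" "set_pressure f Z (1 / real (Suc k)) < ereal \<alpha>"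
        unfolding measure_pressure_at_def Inf_less_iff by auto
      then show ?thesis
        using invariant_measuresD(2)[OF inv] by (intro exI[of _ Z]) (simp add: measure_def)
    qed
    then obtain Z where Z: "\<And>k. Z k \<in> sets borel" "\<And>k. measure \<mu> (Z k) = 1"
      "\<And>k. set_pressure f (Z k) (1 / real (Suc k)) < ereal \<alpha>" by metis
    \<comment> \<open>Scales 1 / (k + 1) suffice for the pressure, so the exceptional components
      form a countable union of null sets.\<close>
    have "AE \<nu> in \<tau>\<^sub>E. \<forall>k. measure \<nu> (Z k) = 1"
      unfolding AE_all_countable using full_measure_iff[OF Z(1)] Z(2) by blast
    then have "AE \<nu> in \<tau>\<^sub>E. ks_entropy \<nu> f \<le> ereal \<alpha>"
      using AE_space
    proof eventually_elim
      case (elim \<nu>)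
      then have nu: "\<nu> \<in> invariant_measures f" by (simp add: space_restrict ergodic_imp_invariant)
      have "measure_pressure f \<nu> \<le> ereal \<alpha>"
      proof (rule measure_pressure_le)
        fix k
        have "measure_pressure_at f \<nu> (1 / real (Suc k)) \<le> set_pressure f (Z k) (1 / real (Suc k))"
          by (rule measure_pressure_at_le_set_pressure[OF nu Z(1)]) (use elim in blast)
        then show "measure_pressure_at f \<nu> (1 / real (Suc k)) \<le> ereal \<alpha>"
          using Z(3)[of k] by (meson le_less_trans less_imp_le)
      qed
      with ks_entropy_le_measure_pressure[OF compact_UNIV nu] show ?case by (rule order_trans)
    qed
    then have "?s \<le> ereal \<alpha>" by (rule esssup_I[OF ks_entropy_measurable])
    then show False using \<alpha>(2) by (simp add: leD)
  qed
qed

end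

theorem corollary4p3:
  fixes f :: "'a::metric_space \<Rightarrow> 'a" and \<mu> :: "'a measure"
  assumes "compact (UNIV :: 'a set)"
    and "continuous_on UNIV f"
    and "\<mu> \<in> invariant_measures f"
  shows "(\<forall>\<tau>. ergodic_decomposition f \<mu> \<tau> \<longrightarrow>
            measure_pressure f \<mu> =
              esssup (restrict_space \<tau> (ergodic_measures f)) (\<lambda>\<nu>. ks_entropy \<nu> f))
         \<and> measure_pressure f \<mu> \<ge> ks_entropy \<mu> f"
proof (intro conjI allI impI)
  show "measure_pressure f \<mu> = esssup (restrict_space \<tau> (ergodic_measures f)) (\<lambda>\<nu>. ks_entropy \<nu> f)"
    if "ergodic_decomposition f \<mu> \<tau>" for \<tau>
    by (intro ergodic_decomposition_setting.measure_pressure_eq_esssup ergodic_decomposition_setting.intro assms that)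
  show "ks_entropy \<mu> f \<le> measure_pressure f \<mu>"
    by (rule ks_entropy_le_measure_pressure[OF assms(1,3)])
qed

end
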